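(* Let $X$ and $X'$ be $\lambda$-synchronizing subshifts (over finite alphabets $\Sigma$ and $\Sigma'$). If $X$ is topologically conjugate to $X'$, then the symbolic matrix system $(\mathcal M^{\lambda(X)},I^{\lambda(X)})$ of the $\lambda$-graph system $\mathfrak L^{\lambda(X)}$ is strong shift equivalent to the symbolic matrix system $(\mathcal M^{\lambda(X')},I^{\lambda(X')})$ of $\mathfrak L^{\lambda(X')}$.
   Context: Subshifts. A subshift is a closed shift-invariant $X\subset\Sigma^{\mathbb Z}$; a topological conjugacy is a shift-commuting homeomorphism. $\mathcal L(X)$ is the set of (nonempty) finite words appearing in points of $X$, $\mathcal L_n(X)$ those of length $n$. $\Gamma^+(a)=\{c\in\mathcal L(X): ac\in\mathcal L(X)\}$, $\Gamma^-_l(a)=\{c\in\mathcal L_l(X): ca\in\mathcal L(X)\}$, $\omega^-_l(a)=\bigcap_{c\in\Gamma^+(a)}\{b\in\mathcal L_l(X): bac\in\mathcal L(X)\}$. A word $v\in\mathcal L(X)$ is $l$-synchronizing if $\Gamma^-_l(v)\subset\omega^-_l(v)$; $\mathcal S_l(X)$ is the set of these words. $X$ is $\lambda$-synchronizing if for all $w\in\mathcal L(X)$, $k\in\mathbb N$ there is $v\in\mathcal S_k(X)\cap\Gamma^+(w)$. Words $\mu,\nu\in\mathcal L(X)$ are $l$-past equivalent if $\Gamma^-_l(\mu)=\Gamma^-_l(\nu)$; $[\mu]_l$ is the $l$-past equivalence class of $\mu\in\mathcal S_l(X)$. By convention $\mathcal S_0(X)=\mathcal L(X)$ and all words are $0$-past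 equivalent. The $\lambda$-graph system $\mathfrak L^{\lambda(X)}$: vertex sets $V_l^{\lambda(X)}=\{[\mu]_l:\mu\in\mathcal S_l(X)\}$, $l\in\mathbb Z_+$; for $\nu\in\mathcal S_{l+1}(X)$ and $\alpha\in\Gamma^-_1(\nu)$ an edge labeled $\alpha$ from $[\alpha\nu]_l\in V_l^{\lambda(X)}$ to $[\nu]_{l+1}\in V_{l+1}^{\lambda(X)}$ (one edge per triple (source, label, terminal)); surjections $\iota_{l,l+1}([\mu]_{l+1})=[\mu]_l$. Symbolic matrix systems. A symbolic matrix over an alphabet has as entries finite formal sums (possibly $0$) of symbols; products of symbolic matrices over alphabets $C$ and $D$ have entries finite formal sums of words in $CD=\{cd: c\in C,d\in D\}$. A symbolic matrix system $(\mathcal M,I)$ over $\Sigma$ is a sequence of pairs $(\mathcal M_{l,l+1},I_{l,l+1})$, $l\in\mathbb Z_+$, of $m(l)\times m(l+1)$ matrices, with $\mathcal M_{l,l+1}$ symbolic over $\Sigma$ and $I_{l,l+1}$ a $\{0,1\}$-matrix with no zero row and exactly one $1$ in each column, such that $I_{l,l+1}\mathcal M_{l+1,l+2}=\mathcal M_{l,l+1}I_{l+1,l+2}$. The symbolic matrix system of $\mathfrak L^{\lambda(X)}$ is obtained by enumerating $V_l^{\lambda(X)}=\{v^l_1,\dots,v^l_{m(l)}\}$, letting $\mathcal M^{\lambda(X)}_{l,l+1}(i,j)$ be the formal sum of the labels of the edges from $v_i^l$ to $v_j^{l+1}$ and $I^{\lambda(X)}_{l,l+1}(i,j)=1$ if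 $\iota(v_j^{l+1})=v_i^l$, and $0$ otherwise. Strong shift equivalence. Two symbolic matrix systems $(\mathcal M,I)$ over $\Sigma$ (sizes $m(l)$) and $(\mathcal M',I')$ over $\Sigma'$ (sizes $m'(l)$) are strong shift equivalent in one step if there are alphabets $C,D$, injective maps $\varphi:\Sigma\to CD$, $\varphi':\Sigma'\to DC$, and for each $l\in\mathbb N$ an $m(l-1)\times m'(l)$ symbolic matrix $\mathcal H_l$ over $C$ and an $m'(l-1)\times m(l)$ symbolic matrix $\mathcal K_l$ over $D$ such that for all $l\in\mathbb N$: applying $\varphi$ to the symbols of $I_{l-1,l}\mathcal M_{l,l+1}$ gives $\mathcal H_l\mathcal K_{l+1}$; applying $\varphi'$ to the symbols of $I'_{l-1,l}\mathcal M'_{l,l+1}$ gives $\mathcal K_l\mathcal H_{l+1}$; and $\mathcal H_lI'_{l,l+1}=I_{l-1,l}\mathcal H_{l+1}$, $\mathcal K_lI_{l,l+1}=I'_{l-1,l}\mathcal K_{l+1}$. They are strong shift equivalent if they are connected by a finite chain of symbolic matrix systems in which consecutive ones are strong shift equivalent in one step. *)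

theory Defs
  imports "HOL-Analysis.Function_Topology" "HOL-Library.Multiset" "Jordan_Normal_Form.Matrix"
begin

section \<open>Subshifts and topological conjugacy\<close>

text \<open>The topology on the full shift is the product topology over the discrete alphabet \<open>A\<close>;
  its carrier is the set of all bi-infinite sequences with values in \<open>A\<close>.\<close>

definition full_shift :: "'a set \<Rightarrow> (int \<Rightarrow> 'a) topology" where
  "full_shift A = product_topology (\<lambda>_. discrete_topology A) UNIV"

definition shift :: "(int \<Rightarrow> 'a) \<Rightarrow> (int \<Rightarrow> 'a)" where
  "shift x = (\<lambda>n. x (n + 1))"

definition subshift :: "'a set \<Rightarrow> (int \<Rightarrow> 'a) set \<Rightarrow> bool" where
  "subshift A X \<longleftrightarrow> closedin (full_shift A) X \<and> shift ` X = X"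

definition topologically_conjugate ::
  "'a set \<Rightarrow> (int \<Rightarrow> 'a) set \<Rightarrow> 'b set \<Rightarrow> (int \<Rightarrow> 'b) set \<Rightarrow> bool" where
  "topologically_conjugate A X A' X' \<longleftrightarrow>
     (\<exists>h. homeomorphic_map (subtopology (full_shift A) X) (subtopology (full_shift A') X') h \<and>
          (\<forall>x\<in>X. h (shift x) = shift (h x)))"


section \<open>Words and \<open>\<lambda>\<close>-synchronization\<close>

text \<open>Only nonempty words are admitted. In particular \<open>lang_len X 0\<close> is empty, so that the
  conventions for \<open>l = 0\<close> (every word is 0-synchronizing, all words are 0-past equivalent) need no
  special clause; see \<open>sync_0\<close> and \<open>past_class_0\<close> below.\<close>

definition lang :: "(int \<Rightarrow> 'a) set \<Rightarrow> 'a list set" where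
  "lang X = {w. w \<noteq> [] \<and> (\<exists>x\<in>X. \<exists>i. \<forall>k<length w. w ! k = x (i + int k))}"

definition lang_len :: "(int \<Rightarrow> 'a) set \<Rightarrow> nat \<Rightarrow> 'a list set" where
  "lang_len X n = {w \<in> lang X. length w = n}"

definition Gamma_plus :: "(int \<Rightarrow> 'a) set \<Rightarrow> 'a list \<Rightarrow> 'a list set" where
  "Gamma_plus X a = {c \<in> lang X. a @ c \<in> lang X}"

definition Gamma_minus :: "(int \<Rightarrow> 'a) set \<Rightarrow> nat \<Rightarrow> 'a list \<Rightarrow> 'a list set" where
  "Gamma_minus X l a = {c \<in> lang_len X l. c @ a \<in> lang X}"

definition omega_minus :: "(int \<Rightarrow> 'a) set \<Rightarrow> nat \<Rightarrow> 'a list \<Rightarrow> 'a list set" where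
  "omega_minus X l a = (\<Inter>c\<in>Gamma_plus X a. {b \<in> lang_len X l. b @ a @ c \<in> lang X})"

definition sync :: "(int \<Rightarrow> 'a) set \<Rightarrow> nat \<Rightarrow> 'a list set" where
  "sync X l = {v \<in> lang X. Gamma_minus X l v \<subseteq> omega_minus X l v}"

definition lambda_synchronizing :: "(int \<Rightarrow> 'a) set \<Rightarrow> bool" where
  "lambda_synchronizing X \<longleftrightarrow> (\<forall>w\<in>lang X. \<forall>k\<ge>1. \<exists>v. v \<in> sync X k \<inter> Gamma_plus X w)"

definition past_equiv :: "(int \<Rightarrow> 'a) set \<Rightarrow> nat \<Rightarrow> ('a list \<times> 'a list) set" where
  "past_equiv X l =
     {(\<mu>, \<nu>). \<mu> \<in> lang X \<and> \<nu> \<in> lang X \<and> Gamma_minus X l \<mu> = Gamma_minus X l \<nu>}"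

definition past_class :: "(int \<Rightarrow> 'a) set \<Rightarrow> nat \<Rightarrow> 'a list \<Rightarrow> 'a list set" where
  "past_class X l \<mu> = past_equiv X l `` {\<mu>}"


section \<open>The \<open>\<lambda>\<close>-graph system of a \<open>\<lambda>\<close>-synchronizing subshift\<close>

definition lambda_vertices :: "(int \<Rightarrow> 'a) set \<Rightarrow> nat \<Rightarrow> 'a list set set" where
  "lambda_vertices X l = past_class X l ` sync X l"

text \<open>The edges between levels \<open>l\<close> and \<open>l + 1\<close>, as triples (source, label, terminal).\<close>

definition lambda_edges ::
  "(int \<Rightarrow> 'a) set \<Rightarrow> nat \<Rightarrow> ('a list set \<times> 'a \<times> 'a list set) set" where
  "lambda_edges X l =
     {(past_class X l (\<alpha> # \<nu>), \<alpha>, past_class X (Suc l) \<nu>) | \<alpha> \<nu>.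
        \<nu> \<in> sync X (Suc l) \<and> [\<alpha>] \<in> Gamma_minus X 1 \<nu>}"

text \<open>The map from level \<open>l + 1\<close> to level \<open>l\<close> saturates a class of \<open>(l + 1)\<close>-past equivalence
  with respect to the coarser \<open>l\<close>-past equivalence; see \<open>lambda_iota_past_class\<close> below.\<close>

definition lambda_iota :: "(int \<Rightarrow> 'a) set \<Rightarrow> nat \<Rightarrow> 'a list set \<Rightarrow> 'a list set" where
  "lambda_iota X l U = past_equiv X l `` U"


lemma lang_len_0: "lang_len X 0 = {}"
  by (auto simp: lang_len_def lang_def)

lemma sync_0: "sync X 0 = lang X"
  by (auto simp: sync_def Gamma_minus_def lang_len_0)

lemma past_class_0: "\<mu> \<in> lang X \<Longrightarrow> past_class X 0 \<mu> = lang X"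
  by (auto simp: past_class_def past_equiv_def Gamma_minus_def lang_len_0)

lemma lang_extend_left:
  assumes "w \<in> lang X" shows "\<exists>b. b # w \<in> lang X"
proof -
  obtain x i where x: "x \<in> X" "\<forall>k<length w. w ! k = x (i + int k)" "w \<noteq> []"
    using assms by (auto simp: lang_def)
  have "(x (i - 1) # w) ! k = x ((i - 1) + int k)" if "k < length (x (i - 1) # w)" for k
    using x that by (cases k) auto
  then show ?thesis using x(1) unfolding lang_def by blast
qed

lemma lang_suffix:
  assumes "u @ w \<in> lang X" "w \<noteq> []" shows "w \<in> lang X"
proof -
  obtain x i where x: "x \<in> X" "\<forall>k<length (u @ w). (u @ w) ! k = x (i + int k)"
    using assms by (auto simp: lang_def)
  have "w ! k = x ((i + int (length u)) + int k)" if "k < length w" for k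
    using x(2)[rule_format, of "length u + k"] that by (simp add: add.assoc)
  then show ?thesis using x(1) assms(2) unfolding lang_def by blast
qed

lemma lang_prefix:
  assumes "u @ w \<in> lang X" "u \<noteq> []" shows "u \<in> lang X"
proof -
  obtain x i where x: "x \<in> X" "\<forall>k<length (u @ w). (u @ w) ! k = x (i + int k)"
    using assms by (auto simp: lang_def)
  have "u ! k = x (i + int k)" if "k < length u" for k
    using x(2)[rule_format, of k] that by (simp add: nth_append)
  then show ?thesis using x(1) assms(2) unfolding lang_def by blast
qed

lemma Gamma_minus_from_Suc:
  assumes "l > 0"
  shows "Gamma_minus X l v = tl ` Gamma_minus X (Suc l) v"
proof (intro equalityI subsetI)
  fix c assume c: "c \<in> Gamma_minus X l v"
  then obtain b where b: "b # c @ v \<in> lang X"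
    using lang_extend_left by (auto simp: Gamma_minus_def)
  then have "b # c \<in> lang X" using lang_prefix[of "b # c" v X] by simp
  with b c have "b # c \<in> Gamma_minus X (Suc l) v"
    by (simp add: Gamma_minus_def lang_len_def)
  then show "c \<in> tl ` Gamma_minus X (Suc l) v" by force
next
  fix c assume "c \<in> tl ` Gamma_minus X (Suc l) v"
  then obtain b where b: "b # c \<in> lang X" "b # c @ v \<in> lang X" "length c = l"
    by (auto simp: Gamma_minus_def lang_len_def length_Suc_conv)
  then have "c \<noteq> []" using assms by auto
  then show "c \<in> Gamma_minus X l v"
    using b lang_suffix[of "[b]" c X] lang_suffix[of "[b]" "c @ v" X]
    by (simp add: Gamma_minus_def lang_len_def)
qed

lemma past_equiv_Suc: "past_equiv X (Suc l) \<subseteq> past_equiv X l"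
proof (cases "l = 0")
  case True
  then show ?thesis by (auto simp: past_equiv_def Gamma_minus_def[of X 0] lang_len_0)
next
  case False
  then have "Gamma_minus X l v = tl ` Gamma_minus X (Suc l) v" for v
    by (intro Gamma_minus_from_Suc) simp
  then show ?thesis unfolding past_equiv_def by clarsimp
qed

lemma lambda_iota_past_class:
  assumes "\<mu> \<in> sync X (Suc l)"
  shows "lambda_iota X l (past_class X (Suc l) \<mu>) = past_class X l \<mu>"
proof -
  have "\<mu> \<in> past_class X (Suc l) \<mu>"
    using assms by (auto simp: past_class_def past_equiv_def sync_def)
  moreover have "past_class X (Suc l) \<mu> \<subseteq> past_class X l \<mu>"
    using past_equiv_Suc by (auto simp: past_class_def)
  ultimately show ?thesis
    by (fastforce simp: lambda_iota_def past_class_def past_equiv_def)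
qed


section \<open>Symbolic matrix systems\<close>

text \<open>A finite formal sum of symbols is a multiset, the empty multiset being \<open>0\<close>.
  A word \<open>cd\<close> in \<open>CD\<close> is represented by the pair \<open>(c, d)\<close>, so \<open>CD\<close> is \<open>C \<times> D\<close>.\<close>

type_synonym 'a symbolic_matrix = "'a multiset mat"

definition symbolic_matrix_over :: "'a set \<Rightarrow> 'a symbolic_matrix \<Rightarrow> bool" where
  "symbolic_matrix_over C A \<longleftrightarrow> (\<forall>i<dim_row A. \<forall>j<dim_col A. set_mset (A $$ (i, j)) \<subseteq> C)"

text \<open>Matrix multiplication with respect to a product \<open>f\<close> of entries of different types.\<close>

definition mat_mult_by ::
  "('a \<Rightarrow> 'b \<Rightarrow> 'c::comm_monoid_add) \<Rightarrow> 'a mat \<Rightarrow> 'b mat \<Rightarrow> 'c mat" where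
  "mat_mult_by f A B = mat (dim_row A) (dim_col B)
     (\<lambda>(i, j). \<Sum>k<dim_col A. f (A $$ (i, k)) (B $$ (k, j)))"

definition formal_product :: "'c multiset \<Rightarrow> 'd multiset \<Rightarrow> ('c \<times> 'd) multiset" where
  "formal_product P Q = (\<Sum>c\<in>#P. image_mset (Pair c) Q)"

definition sym_mult ::
  "'c symbolic_matrix \<Rightarrow> 'd symbolic_matrix \<Rightarrow> ('c \<times> 'd) symbolic_matrix" where
  "sym_mult = mat_mult_by formal_product"

definition int_sym_mult :: "nat mat \<Rightarrow> 'a symbolic_matrix \<Rightarrow> 'a symbolic_matrix" where
  "int_sym_mult = mat_mult_by repeat_mset"

definition sym_int_mult :: "'a symbolic_matrix \<Rightarrow> nat mat \<Rightarrow> 'a symbolic_matrix" where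
  "sym_int_mult = mat_mult_by (\<lambda>P n. repeat_mset n P)"

definition map_symbols :: "('a \<Rightarrow> 'b) \<Rightarrow> 'a symbolic_matrix \<Rightarrow> 'b symbolic_matrix" where
  "map_symbols \<phi> = map_mat (image_mset \<phi>)"

text \<open>\<open>sms_M S l\<close> and \<open>sms_I S l\<close> are the matrices with index pair \<open>l, l + 1\<close>.\<close>

record 'a sms =
  sms_alphabet :: "'a set"
  sms_size :: "nat \<Rightarrow> nat"
  sms_M :: "nat \<Rightarrow> 'a symbolic_matrix"
  sms_I :: "nat \<Rightarrow> nat mat"

definition symbolic_matrix_system :: "'a sms \<Rightarrow> bool" where
  "symbolic_matrix_system S \<longleftrightarrow>
     finite (sms_alphabet S) \<and>
     (\<forall>l. sms_M S l \<in> carrier_mat (sms_size S l) (sms_size S (l + 1)) \<and>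
          symbolic_matrix_over (sms_alphabet S) (sms_M S l) \<and>
          sms_I S l \<in> carrier_mat (sms_size S l) (sms_size S (l + 1)) \<and>
          (\<forall>i<sms_size S l. \<forall>j<sms_size S (l + 1). sms_I S l $$ (i, j) \<in> {0, 1}) \<and>
          (\<forall>i<sms_size S l. \<exists>j<sms_size S (l + 1). sms_I S l $$ (i, j) \<noteq> 0) \<and>
          (\<forall>j<sms_size S (l + 1). \<exists>!i. i < sms_size S l \<and> sms_I S l $$ (i, j) = 1) \<and>
          int_sym_mult (sms_I S l) (sms_M S (l + 1)) = sym_int_mult (sms_M S l) (sms_I S (l + 1)))"

text \<open>The symbolic matrix system of the \<open>\<lambda>\<close>-graph system with respect to enumerations
  \<open>e l 0, e l 1, \<dots>\<close> (starting at index 0) of the vertices of each level \<open>l\<close>.\<close>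

definition vertex_enumeration :: "(int \<Rightarrow> 'a) set \<Rightarrow> (nat \<Rightarrow> nat \<Rightarrow> 'a list set) \<Rightarrow> bool" where
  "vertex_enumeration X e \<longleftrightarrow>
     (\<forall>l. bij_betw (e l) {..<card (lambda_vertices X l)} (lambda_vertices X l))"

definition lambda_sms ::
  "'a set \<Rightarrow> (int \<Rightarrow> 'a) set \<Rightarrow> (nat \<Rightarrow> nat \<Rightarrow> 'a list set) \<Rightarrow> 'a sms" where
  "lambda_sms A X e = \<lparr>
     sms_alphabet = A,
     sms_size = (\<lambda>l. card (lambda_vertices X l)),
     sms_M = (\<lambda>l. mat (card (lambda_vertices X l)) (card (lambda_vertices X (l + 1)))
       (\<lambda>(i, j). mset_set {\<alpha>. (e l i, \<alpha>, e (l + 1) j) \<in> lambda_edges X l})),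
     sms_I = (\<lambda>l. mat (card (lambda_vertices X l)) (card (lambda_vertices X (l + 1)))
       (\<lambda>(i, j). if lambda_iota X l (e (l + 1) j) = e l i then 1 else 0))\<rparr>"


section \<open>Strong shift equivalence\<close>

text \<open>The auxiliary alphabets \<open>C\<close> and \<open>D\<close> are finite sets of natural numbers, which is no
  restriction as only their cardinality matters. Since words in \<open>CD\<close> and \<open>DC\<close> are pairs,
  \<open>C\<close> and \<open>D\<close> need not be disjoint.\<close>

definition sse_one_step :: "'a sms \<Rightarrow> 'b sms \<Rightarrow> bool" where
  "sse_one_step S S' \<longleftrightarrow>
     symbolic_matrix_system S \<and> symbolic_matrix_system S' \<and>
     (\<exists>(C :: nat set) (D :: nat set) \<phi> \<phi>' H K.
        finite C \<and> finite D \<and>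
        \<phi> \<in> sms_alphabet S \<rightarrow> C \<times> D \<and> inj_on \<phi> (sms_alphabet S) \<and>
        \<phi>' \<in> sms_alphabet S' \<rightarrow> D \<times> C \<and> inj_on \<phi>' (sms_alphabet S') \<and>
        (\<forall>l\<ge>1.
           H l \<in> carrier_mat (sms_size S (l - 1)) (sms_size S' l) \<and> symbolic_matrix_over C (H l) \<and>
           K l \<in> carrier_mat (sms_size S' (l - 1)) (sms_size S l) \<and> symbolic_matrix_over D (K l)) \<and>
        (\<forall>l\<ge>1.
           map_symbols \<phi> (int_sym_mult (sms_I S (l - 1)) (sms_M S l)) = sym_mult (H l) (K (l + 1)) \<and>
           map_symbols \<phi>' (int_sym_mult (sms_I S' (l - 1)) (sms_M S' l)) = sym_mult (K l) (H (l + 1)) \<and>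
           sym_int_mult (H l) (sms_I S' l) = int_sym_mult (sms_I S (l - 1)) (H (l + 1)) \<and>
           sym_int_mult (K l) (sms_I S l) = int_sym_mult (sms_I S' (l - 1)) (K (l + 1))))"

text \<open>A finite chain of one-step equivalences. The alphabets of the end points have arbitrary types;
  those of the intermediate systems are finite sets of natural numbers, which up to renaming of
  symbols is no restriction. Intermediate systems are symbolic matrix systems by the
  definition of \<open>sse_one_step\<close>.\<close>

definition strong_shift_equivalent :: "'a sms \<Rightarrow> 'b sms \<Rightarrow> bool" where
  "strong_shift_equivalent S S' \<longleftrightarrow>
     sse_one_step S S' \<or>
     (\<exists>(T :: nat sms) (T' :: nat sms).
        sse_one_step S T \<and> sse_one_step\<^sup>*\<^sup>* T T' \<and> sse_one_step T' S')"

end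

(*
  Suppose that X and X' are the recodings x_i = (c_i, d_i) and x'_i = (d_i, c_{i+1}) of the same
  bi-infinite words ... c_0 d_0 c_1 d_1 ...; let Y be the set of these words. Then the vertices of
  level l of X (of X') are the classes of pasts of length 2l of words of Y that begin with a letter
  c (a letter d). For levels j and k of Y, a synchronizing word w of level k and a word u of length
  at most k - j with uw in the language of Y, draw a link labelled u from the class of uw at level j
  to the class of w at level k. Links compose uniquely: the links labelled uv from j to m are exactly
  the compositions of links labelled u from j to k with links labelled v from k to m. The matrices
  I, M, H, K count the links with label empty, cd or dc, c, and d, so every identity required of a
  strong shift equivalence in one step is an instance of this composition law.

  A conjugacy is a chain of such steps. If the symbol q_i is a function of p_i, then passing from
  p_i to (p_i, q_{i+1}) is a step with c = q and d = p, and similarly on the left, so p is connected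
  to p together with any window of q. A conjugacy h and its inverse have windows n and m; hence x is
  connected to its window of radius n, this to its extension by the window of h(x) of radius m + n,
  which carries the same information as that window of h(x) alone, and the latter to h(x).
*)
theory Submission
  imports Defs
begin

section \<open>Pasts and links\<close>

text \<open>Unlike in \<open>Gamma_minus\<close>, the empty word counts as a past. At level 0 every
  word of the language therefore has the set \<open>{[]}\<close>, which gives the trivial 0-past
  equivalence and lets words be prepended without a case distinction.\<close>

definition pasts :: "(int \<Rightarrow> 'a) set \<Rightarrow> nat \<Rightarrow> 'a list \<Rightarrow> 'a list set" where
  "pasts X l w = {c. length c = l \<and> c @ w \<in> lang X}"

lemma lang_nonempty: "w \<in> lang X \<Longrightarrow> w \<noteq> []"
  by (simp add: lang_def)

lemma lang_extend_left_length:
  assumes "w \<in> lang X" shows "\<exists>b. length b = n \<and> b @ w \<in> lang X"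
proof (induction n)
  case 0
  then show ?case using assms by simp
next
  case (Suc n)
  then obtain b where b: "length b = n" "b @ w \<in> lang X" by blast
  obtain a where "a # b @ w \<in> lang X" using lang_extend_left[OF b(2)] by blast
  then have "length (a # b) = Suc n \<and> (a # b) @ w \<in> lang X" using b by simp
  then show ?case by blast
qed

lemma lang_extend_right:
  assumes "w \<in> lang X" shows "\<exists>b. w @ [b] \<in> lang X"
proof -
  obtain x i where x: "x \<in> X" "\<forall>k<length w. w ! k = x (i + int k)"
    using assms by (auto simp: lang_def)
  have "(w @ [x (i + int (length w))]) ! k = x (i + int k)"
    if "k < length (w @ [x (i + int (length w))])" for k
    using x(2) that by (auto simp: nth_append less_Suc_eq)
  then show ?thesis using x(1) unfolding lang_def by blast
qed

text \<open>A past of length j of one word extends to the left to a past of length k, which is then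
  a past of the other word; deleting the added letters leaves a past of length j.\<close>

lemma pasts_mono:
  assumes "pasts X k w = pasts X k w'" "w \<in> lang X" "w' \<in> lang X" "j \<le> k"
  shows "pasts X j w = pasts X j w'"
proof -
  have "pasts X j v \<subseteq> pasts X j v'"
    if h: "pasts X k v = pasts X k v'" "v' \<in> lang X" for v v'
  proof
    fix c assume c: "c \<in> pasts X j v"
    then have cv: "c @ v \<in> lang X" and l: "length c = j" by (auto simp: pasts_def)
    obtain b where b: "length b = k - j" "b @ c @ v \<in> lang X"
      using lang_extend_left_length[OF cv] by blast
    have "b @ c \<in> pasts X k v" using b l assms(4) by (simp add: pasts_def)
    then have "b @ c @ v' \<in> lang X" unfolding h(1) by (simp add: pasts_def)
    moreover have "c @ v' \<noteq> []" using lang_nonempty[OF h(2)] by simp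
    ultimately have "c @ v' \<in> lang X" by (rule lang_suffix)
    then show "c \<in> pasts X j v'" using l by (simp add: pasts_def)
  qed
  from this[OF assms(1) assms(3)] this[OF assms(1)[symmetric] assms(2)]
  show ?thesis by (rule equalityI)
qed

lemma pasts_append: "pasts X j (u @ w) = {c. length c = j \<and> c @ u \<in> pasts X (j + length u) w}"
  by (simp add: pasts_def)

text \<open>The pasts of \<open>u @ w\<close> come from those longer pasts of \<open>w\<close> that
  end in \<open>u\<close>. Prepending a word thus costs as many levels as it has letters.\<close>

lemma pasts_append_cong:
  assumes "pasts X k w = pasts X k w'" "w \<in> lang X" "w' \<in> lang X" "length u + j \<le> k"
  shows "pasts X j (u @ w) = pasts X j (u @ w')"
proof -
  have "pasts X (j + length u) w = pasts X (j + length u) w'"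
    by (rule pasts_mono[OF assms(1-3)]) (use assms(4) in simp)
  then show ?thesis by (simp only: pasts_append)
qed

lemma lang_append_cong:
  assumes "pasts X k w = pasts X k w'" "w \<in> lang X" "w' \<in> lang X" "length u \<le> k"
  shows "u @ w \<in> lang X \<longleftrightarrow> u @ w' \<in> lang X"
proof -
  have "pasts X 0 (u @ w) = pasts X 0 (u @ w')"
    using assms(4) by (intro pasts_append_cong[OF assms(1-3)]) simp
  then have "[] \<in> pasts X 0 (u @ w) \<longleftrightarrow> [] \<in> pasts X 0 (u @ w')" by (simp only:)
  then show ?thesis by (simp add: pasts_def)
qed

section \<open>Past equivalence and synchronization in terms of pasts\<close>

lemma Gamma_minus_eq_pasts: "l > 0 \<Longrightarrow> w \<in> lang X \<Longrightarrow> Gamma_minus X l w = pasts X l w"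
  using lang_prefix by (fastforce simp: Gamma_minus_def pasts_def lang_len_def)

lemma Gamma_minus_eq_iff:
  assumes "w \<in> lang X" "w' \<in> lang X"
  shows "Gamma_minus X l w = Gamma_minus X l w' \<longleftrightarrow> pasts X l w = pasts X l w'"
proof (cases "l = 0")
  case True
  then show ?thesis using assms by (auto simp: Gamma_minus_def lang_len_0 pasts_def)
next
  case False
  then show ?thesis using assms by (simp add: Gamma_minus_eq_pasts)
qed

lemma past_class_eq_iff:
  assumes "w \<in> lang X" "w' \<in> lang X"
  shows "past_class X l w = past_class X l w' \<longleftrightarrow> pasts X l w = pasts X l w'"
  using assms unfolding past_class_def past_equiv_def
  by (subst Gamma_minus_eq_iff[symmetric]) auto

text \<open>Nonempty prefixes of words of the language belong to the language, so a continuation can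
  only remove pasts. Synchronization says that none are removed; the empty continuation, which
  \<open>Gamma_plus\<close> excludes, imposes no condition.\<close>

lemma sync_iff:
  "w \<in> sync X l \<longleftrightarrow> w \<in> lang X \<and> (\<forall>c. w @ c \<in> lang X \<longrightarrow> pasts X l (w @ c) = pasts X l w)"
proof (cases "l = 0 \<or> w \<notin> lang X")
  case True
  then show ?thesis by (auto simp: sync_def Gamma_minus_def lang_len_0 pasts_def)
next
  case False
  then have w: "w \<in> lang X" "l > 0" by auto
  have sub: "pasts X l (w @ c) \<subseteq> pasts X l w" for c
  proof
    fix b assume "b \<in> pasts X l (w @ c)"
    then have "(b @ w) @ c \<in> lang X" "length b = l" by (auto simp: pasts_def)
    moreover have "b @ w \<noteq> []" using lang_nonempty[OF w(1)] by simp
    ultimately show "b \<in> pasts X l w" using lang_prefix[of "b @ w" c X] by (simp add: pasts_def)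
  qed
  have pl: "b \<in> lang_len X l" if "b \<in> pasts X l w" for b
    using that w lang_prefix[of b w X] by (auto simp: pasts_def lang_len_def)
  have "w \<in> sync X l \<longleftrightarrow> (\<forall>c\<in>Gamma_plus X w. pasts X l w \<subseteq> pasts X l (w @ c))"
  proof -
    have "b \<in> omega_minus X l w \<longleftrightarrow> (\<forall>c\<in>Gamma_plus X w. b \<in> pasts X l (w @ c))"
      if "b \<in> pasts X l w" for b
      using pl[OF that] by (simp add: omega_minus_def pasts_def lang_len_def)
    moreover have "w \<in> sync X l \<longleftrightarrow> pasts X l w \<subseteq> omega_minus X l w"
      using w(1) Gamma_minus_eq_pasts[OF w(2,1)] by (simp add: sync_def)
    ultimately show ?thesis by blast
  qed
  also have "\<dots> \<longleftrightarrow> (\<forall>c. w @ c \<in> lang X \<longrightarrow> pasts X l w \<subseteq> pasts X l (w @ c))"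
  proof (intro iffI allI impI ballI)
    fix c assume h: "\<forall>c\<in>Gamma_plus X w. pasts X l w \<subseteq> pasts X l (w @ c)" "w @ c \<in> lang X"
    show "pasts X l w \<subseteq> pasts X l (w @ c)"
    proof (cases "c = []")
      case False
      then have "c \<in> Gamma_plus X w" using h(2) lang_suffix by (auto simp: Gamma_plus_def)
      then show ?thesis using h(1) by blast
    qed simp
  qed (auto simp: Gamma_plus_def)
  finally show ?thesis using sub w(1) by blast
qed

lemma sync_lang: "w \<in> sync X l \<Longrightarrow> w \<in> lang X"
  by (simp add: sync_def)

text \<open>The pasts of length j of \<open>u @ w\<close> are read off from pasts of
  \<open>w\<close> of length at most k, and these do not react to continuations.\<close>

lemma sync_append_left:
  assumes "w \<in> sync X k" "u @ w \<in> lang X" "length u + j \<le> k"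
  shows "u @ w \<in> sync X j"
  unfolding sync_iff
proof (intro conjI allI impI)
  fix c assume c: "(u @ w) @ c \<in> lang X"
  have w: "w \<in> lang X" using assms(1) by (rule sync_lang)
  have wc: "w @ c \<in> lang X"
    by (rule lang_suffix[of u]) (use c lang_nonempty[OF w] in simp_all)
  have "pasts X k (w @ c) = pasts X k w" using assms(1) wc by (simp add: sync_iff)
  from pasts_append_cong[OF this wc w assms(3)]
  show "pasts X j ((u @ w) @ c) = pasts X j (u @ w)" by simp
qed (rule assms(2))

lemma sync_mono: "w \<in> sync X k \<Longrightarrow> j \<le> k \<Longrightarrow> w \<in> sync X j"
  using sync_append_left[of w X k "[]" j] sync_lang[of w X k] by simp

lemma sync_append_right:
  assumes "w \<in> sync X k" "w @ c \<in> lang X"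
  shows "w @ c \<in> sync X k"
  unfolding sync_iff
proof (intro conjI allI impI)
  fix d assume d: "(w @ c) @ d \<in> lang X"
  then have "pasts X k (w @ c @ d) = pasts X k w" using assms(1) by (simp add: sync_iff)
  moreover have "pasts X k (w @ c) = pasts X k w" using assms by (simp add: sync_iff)
  ultimately show "pasts X k ((w @ c) @ d) = pasts X k (w @ c)" by simp
qed (rule assms(2))

lemma finite_lambda_vertices:
  assumes "finite A" "\<And>x i. x \<in> X \<Longrightarrow> x i \<in> A"
  shows "finite (lambda_vertices X l)"
proof -
  have "set w \<subseteq> A" if "w \<in> lang X" for w
    using that assms(2) by (auto simp: lang_def in_set_conv_nth)
  then have "lang_len X l \<subseteq> {w. set w \<subseteq> A \<and> length w = l}" by (auto simp: lang_len_def)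
  then have fin: "finite (lang_len X l)"
    using finite_lists_length_eq[OF assms(1)] by (rule finite_subset)
  let ?f = "\<lambda>G. {\<nu> \<in> lang X. Gamma_minus X l \<nu> = G}"
  have "lambda_vertices X l \<subseteq> ?f ` Pow (lang_len X l)"
  proof
    fix V assume "V \<in> lambda_vertices X l"
    then obtain \<mu> where \<mu>: "\<mu> \<in> lang X" "V = past_class X l \<mu>"
      by (auto simp: lambda_vertices_def sync_def)
    then have "V = ?f (Gamma_minus X l \<mu>)" by (auto simp: past_class_def past_equiv_def)
    moreover have "Gamma_minus X l \<mu> \<in> Pow (lang_len X l)" by (auto simp: Gamma_minus_def)
    ultimately show "V \<in> ?f ` Pow (lang_len X l)" by blast
  qed
  then show ?thesis using fin by (meson finite_Pow_iff finite_imageI finite_subset)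
qed

text \<open>The vertices of the \<open>\<lambda>\<close>-graph system of a subshift over tagged symbols; the tag matters
  only at level 0, where the set of pasts is trivial.\<close>

definition vert :: "(int \<Rightarrow> 't \<times> 'a) set \<Rightarrow> nat \<Rightarrow> ('t \<times> 'a) list \<Rightarrow> 't \<times> ('t \<times> 'a) list set" where
  "vert Y k w = (fst (hd w), pasts Y k w)"

text \<open>Edges that read a whole word \<open>u\<close> while descending from level \<open>j\<close> to level \<open>k\<close>; with
  \<open>u = []\<close> they describe \<open>\<iota>\<close>.\<close>

definition link where
  "link Y j k s u t \<longleftrightarrow> (\<exists>w\<in>sync Y k. u @ w \<in> lang Y \<and> s = vert Y j (u @ w) \<and> t = vert Y k w)"

lemma vert_append_cong:
  assumes "vert X k w = vert X k w'" "w \<in> lang X" "w' \<in> lang X" "length u + j \<le> k"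
  shows "vert X j (u @ w) = vert X j (u @ w')"
  using assms pasts_append_cong[of X k w w' u j] by (cases u) (auto simp: vert_def)

text \<open>The left-resolving property: label and target determine the source. Because of it the
  matrix products below produce no repeated symbols and reduce to unions of sets.\<close>

lemma link_source_unique:
  assumes "link Y k m t v r" "link Y k m t' v r" "length v + k \<le> m"
  shows "t = t'"
proof -
  obtain w w' where w: "w \<in> sync Y m" "t = vert Y k (v @ w)" "r = vert Y m w"
    and w': "w' \<in> sync Y m" "t' = vert Y k (v @ w')" "r = vert Y m w'"
    using assms(1,2) unfolding link_def by blast
  have "vert Y m w = vert Y m w'" using w w' by simp
  from vert_append_cong[OF this sync_lang[OF w(1)] sync_lang[OF w'(1)] assms(3)]
  show ?thesis using w w' by simp
qed

lemma link_source_vertex: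
  assumes "link Y k m t v r" "length v + k \<le> m"
  shows "t \<in> vert Y k ` sync Y k"
proof -
  obtain w where w: "w \<in> sync Y m" "v @ w \<in> lang Y" "t = vert Y k (v @ w)"
    using assms(1) unfolding link_def by blast
  then show ?thesis using sync_append_left[OF w(1,2) assms(2)] by blast
qed

text \<open>At the middle vertex two representatives meet: the target word \<open>w\<close> of the
  upper link and the source word \<open>v @ w'\<close> of the lower one. Having the same pasts of
  length k, they are interchangeable behind \<open>u\<close>. Conversely, a link labelled
  \<open>u @ v\<close> is cut at the class of \<open>v @ w\<close>, which synchronizes at level
  k.\<close>

lemma link_compose:
  assumes "length u + j \<le> k" "length v + k \<le> m"
  shows "(\<exists>t. link Y j k s u t \<and> link Y k m t v r) \<longleftrightarrow> link Y j m s (u @ v) r"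
proof
  assume "\<exists>t. link Y j k s u t \<and> link Y k m t v r"
  then obtain w w' where w: "w \<in> sync Y k" "u @ w \<in> lang Y" "s = vert Y j (u @ w)"
    and w': "w' \<in> sync Y m" "v @ w' \<in> lang Y" "r = vert Y m w'"
    and eq: "vert Y k w = vert Y k (v @ w')"
    unfolding link_def by blast
  have lw: "w \<in> lang Y" using w(1) by (rule sync_lang)
  have "u @ v @ w' \<in> lang Y"
    using lang_append_cong[of Y k w "v @ w'" u] lw w' w(2) eq assms(1) by (simp add: vert_def)
  moreover have "s = vert Y j (u @ v @ w')"
    using vert_append_cong[OF eq lw w'(2) assms(1)] w(3) by simp
  ultimately show "link Y j m s (u @ v) r" unfolding link_def using w' by auto
next
  assume "link Y j m s (u @ v) r"
  then obtain w where w: "w \<in> sync Y m" "(u @ v) @ w \<in> lang Y" "s = vert Y j ((u @ v) @ w)"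
    "r = vert Y m w"
    unfolding link_def by blast
  have vw: "v @ w \<in> lang Y"
    by (rule lang_suffix[of u]) (use w(2) lang_nonempty[OF sync_lang[OF w(1)]] in simp_all)
  have "v @ w \<in> sync Y k" by (rule sync_append_left[OF w(1) vw assms(2)])
  then have "link Y j k s u (vert Y k (v @ w))" unfolding link_def using w by auto
  moreover have "link Y k m (vert Y k (v @ w)) v r" unfolding link_def using w vw by auto
  ultimately show "\<exists>t. link Y j k s u t \<and> link Y k m t v r" by blast
qed

section \<open>Matrices of links\<close>

definition set_mat :: "nat \<Rightarrow> nat \<Rightarrow> (nat \<Rightarrow> nat \<Rightarrow> 'a set) \<Rightarrow> 'a symbolic_matrix" where
  "set_mat n m S = mat n m (\<lambda>(i, j). mset_set (S i j))"

definition ind_mat :: "nat \<Rightarrow> nat \<Rightarrow> (nat \<Rightarrow> nat \<Rightarrow> bool) \<Rightarrow> nat mat" where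
  "ind_mat n m B = mat n m (\<lambda>(i, j). if B i j then 1 else 0)"

lemma set_mat_carrier [simp]: "set_mat n m S \<in> carrier_mat n m"
  by (simp add: set_mat_def)

lemma set_mat_cong:
  "(\<And>i j. i < n \<Longrightarrow> j < m \<Longrightarrow> S i j = S' i j) \<Longrightarrow> set_mat n m S = set_mat n m S'"
  unfolding set_mat_def by (rule eq_matI) simp_all

lemma symbolic_matrix_over_set_mat:
  assumes "\<And>i j. i < n \<Longrightarrow> j < m \<Longrightarrow> S i j \<subseteq> C"
  shows "symbolic_matrix_over C (set_mat n m S)"
  using assms unfolding symbolic_matrix_over_def set_mat_def
  \<comment> \<open>An infinite entry set gives the empty multiset, the default value of
    \<open>mset_set\<close>.\<close>
  by (auto, metis elem_mset_set empty_iff mset_set.infinite set_mset_empty subsetD)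

lemma sum_mset_set_disjoint:
  fixes m :: nat
  assumes "\<And>k. k < m \<Longrightarrow> finite (S k)"
    and "\<And>k k' x. k < m \<Longrightarrow> k' < m \<Longrightarrow> x \<in> S k \<Longrightarrow> x \<in> S k' \<Longrightarrow> k = k'"
  shows "(\<Sum>k<m. mset_set (S k)) = mset_set (\<Union>k<m. S k)"
  using assms
proof (induction m)
  case 0
  then show ?case by simp
next
  case (Suc m)
  have IH: "(\<Sum>k<m. mset_set (S k)) = mset_set (\<Union>k<m. S k)"
  proof (rule Suc.IH)
    show "finite (S k)" if "k < m" for k using Suc.prems(1) that by simp
    show "k = k'" if "k < m" "k' < m" "x \<in> S k" "x \<in> S k'" for k k' x
      using Suc.prems(2)[of k k' x] that by simp
  qed
  have "(\<Union>k<m. S k) \<inter> S m = {}"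
    using Suc.prems(2)[of _ m] by (auto, metis lessI less_SucI less_irrefl)
  moreover have "finite (\<Union>k<m. S k)" "finite (S m)"
    using Suc.prems(1) by auto
  ultimately have "mset_set ((\<Union>k<m. S k) \<union> S m) = mset_set (\<Union>k<m. S k) + mset_set (S m)"
    by (intro mset_set_Union)
  moreover have "(\<Union>k<Suc m. S k) = (\<Union>k<m. S k) \<union> S m"
    by (simp add: lessThan_Suc Un_commute)
  ultimately show ?case using IH by simp
qed

lemma formal_product_mset_set:
  assumes "finite P" "finite Q"
  shows "formal_product (mset_set P) (mset_set Q) = mset_set (P \<times> Q)"
  using assms(1)
proof (induction P)
  case empty
  then show ?case by (simp add: formal_product_def)
next
  case (insert x P)
  have "image_mset (Pair x) (mset_set Q) = mset_set (Pair x ` Q)"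
    by (rule image_mset_mset_set) (simp add: inj_on_def)
  moreover have "mset_set (insert x P \<times> Q) = mset_set (Pair x ` Q) + mset_set (P \<times> Q)"
  proof -
    have "insert x P \<times> Q = Pair x ` Q \<union> P \<times> Q" by auto
    moreover have "Pair x ` Q \<inter> P \<times> Q = {}" using insert.hyps by auto
    ultimately show ?thesis
      using insert.hyps assms(2) by (simp only: mset_set_Union finite_imageI finite_cartesian_product)
  qed
  ultimately show ?case using insert by (simp add: formal_product_def)
qed

text \<open>The last assumption says that a pair of symbols occurs for at most one middle index, so
  the sum over that index is a disjoint union.\<close>

lemma sym_mult_set_mat:
  assumes "\<And>i k. finite (S i k)" "\<And>k j. finite (T k j)"
    and "\<And>i j k k' c d. i < n \<Longrightarrow> j < p \<Longrightarrow> k < m \<Longrightarrow> k' < m \<Longrightarrow>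
      c \<in> S i k \<Longrightarrow> d \<in> T k j \<Longrightarrow> c \<in> S i k' \<Longrightarrow> d \<in> T k' j \<Longrightarrow> k = k'"
  shows "sym_mult (set_mat n m S) (set_mat m p T) = set_mat n p (\<lambda>i j. \<Union>k<m. S i k \<times> T k j)"
  unfolding sym_mult_def mat_mult_by_def
proof (rule eq_matI, goal_cases)
  case (1 i j)
  then have ij: "i < n" "j < p" by (simp_all add: set_mat_def)
  have "(\<Sum>k<m. formal_product (mset_set (S i k)) (mset_set (T k j)))
      = (\<Sum>k<m. mset_set (S i k \<times> T k j))"
    by (rule sum.cong) (simp_all add: formal_product_mset_set assms(1,2))
  also have "\<dots> = mset_set (\<Union>k<m. S i k \<times> T k j)"
  proof (rule sum_mset_set_disjoint)
    show "finite (S i k \<times> T k j)" for k using assms(1,2) by blast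
    show "k = k'" if "k < m" "k' < m" "x \<in> S i k \<times> T k j" "x \<in> S i k' \<times> T k' j" for k k' x
      using assms(3)[OF ij that(1,2), of "fst x" "snd x"] that(3,4) by auto
  qed
  finally show ?case using ij by (simp add: set_mat_def)
qed (simp_all add: set_mat_def)

lemma int_sym_mult_set_mat:
  assumes "\<And>k j. finite (T k j)"
    and "\<And>i j k k' d. i < n \<Longrightarrow> j < p \<Longrightarrow> k < m \<Longrightarrow> k' < m \<Longrightarrow>
      B i k \<Longrightarrow> d \<in> T k j \<Longrightarrow> B i k' \<Longrightarrow> d \<in> T k' j \<Longrightarrow> k = k'"
  shows "int_sym_mult (ind_mat n m B) (set_mat m p T)
    = set_mat n p (\<lambda>i j. \<Union>k<m. if B i k then T k j else {})"
  unfolding int_sym_mult_def mat_mult_by_def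
proof (rule eq_matI, goal_cases)
  case (1 i j)
  then have ij: "i < n" "j < p" by (simp_all add: set_mat_def ind_mat_def)
  have "(\<Sum>k<m. repeat_mset (if B i k then 1 else 0) (mset_set (T k j)))
      = (\<Sum>k<m. mset_set (if B i k then T k j else {}))"
    by (rule sum.cong) simp_all
  also have "\<dots> = mset_set (\<Union>k<m. if B i k then T k j else {})"
  proof (rule sum_mset_set_disjoint)
    show "finite (if B i k then T k j else {})" for k using assms(1) by simp
    show "k = k'" if "k < m" "k' < m" "x \<in> (if B i k then T k j else {})"
      "x \<in> (if B i k' then T k' j else {})" for k k' x
      using assms(2)[OF ij that(1,2), of x] that(3,4) by (auto split: if_splits)
  qed
  finally show ?case using ij by (simp add: set_mat_def ind_mat_def)
qed (simp_all add: set_mat_def ind_mat_def)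

lemma sym_int_mult_set_mat:
  assumes "\<And>i k. finite (S i k)"
    and "\<And>i j k k' c. i < n \<Longrightarrow> j < p \<Longrightarrow> k < m \<Longrightarrow> k' < m \<Longrightarrow>
      c \<in> S i k \<Longrightarrow> B k j \<Longrightarrow> c \<in> S i k' \<Longrightarrow> B k' j \<Longrightarrow> k = k'"
  shows "sym_int_mult (set_mat n m S) (ind_mat m p B)
    = set_mat n p (\<lambda>i j. \<Union>k<m. if B k j then S i k else {})"
  unfolding sym_int_mult_def mat_mult_by_def
proof (rule eq_matI, goal_cases)
  case (1 i j)
  then have ij: "i < n" "j < p" by (simp_all add: set_mat_def ind_mat_def)
  have "(\<Sum>k<m. repeat_mset (if B k j then 1 else 0) (mset_set (S i k)))
      = (\<Sum>k<m. mset_set (if B k j then S i k else {}))"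
    by (rule sum.cong) simp_all
  also have "\<dots> = mset_set (\<Union>k<m. if B k j then S i k else {})"
  proof (rule sum_mset_set_disjoint)
    show "finite (if B k j then S i k else {})" for k using assms(1) by simp
    show "k = k'" if "k < m" "k' < m" "x \<in> (if B k j then S i k else {})"
      "x \<in> (if B k' j then S i k' else {})" for k k' x
      using assms(2)[OF ij that(1,2), of x] that(3,4) by (auto split: if_splits)
  qed
  finally show ?case using ij by (simp add: set_mat_def ind_mat_def)
qed (simp_all add: set_mat_def ind_mat_def)

lemma map_symbols_set_mat:
  assumes "\<And>i j. i < n \<Longrightarrow> j < m \<Longrightarrow> inj_on \<phi> (S i j)"
  shows "map_symbols \<phi> (set_mat n m S) = set_mat n m (\<lambda>i j. \<phi> ` S i j)"
  unfolding map_symbols_def set_mat_def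
  by (rule eq_matI) (simp_all add: image_mset_mset_set assms)

text \<open>The vertices of levels \<open>j\<close> and \<open>k\<close> are listed by \<open>f\<close> and \<open>g\<close>; the symbols of \<open>C\<close> are read
  as words through \<open>\<gamma>\<close>.\<close>

definition link_mat where
  "link_mat Y j k C \<gamma> n m f g = set_mat n m (\<lambda>i i'. {c \<in> C. link Y j k (f i) (\<gamma> c) (g i')})"

definition link_ind where
  "link_ind Y j k n m f g = ind_mat n m (\<lambda>i i'. link Y j k (f i) [] (g i'))"

text \<open>The tags separate the vertices of the two recodings of one subshift; listing the
  vertices with one tag provides the row and column indices for one of the recodings.\<close>

definition lists_tagged :: "(int \<Rightarrow> 't \<times> 'a) set \<Rightarrow> nat \<Rightarrow> 't \<Rightarrow> nat \<Rightarrow>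
    (nat \<Rightarrow> 't \<times> ('t \<times> 'a) list set) \<Rightarrow> bool" where
  "lists_tagged Y k t m g \<longleftrightarrow> bij_betw g {..<m} {v \<in> vert Y k ` sync Y k. fst v = t}"

lemma link_source_tag: "link Y k m t v r \<Longrightarrow> fst t = (if v = [] then fst r else fst (hd v))"
  by (auto simp: link_def vert_def)

lemma link_target_tag: "lists_tagged Y k t m g \<Longrightarrow> i < m \<Longrightarrow> fst (g i) = t"
  unfolding lists_tagged_def bij_betw_def by blast

lemma lists_tagged_unique:
  assumes "lists_tagged Y k t m g" "i < m" "i' < m" "link Y k l (g i) v r" "link Y k l (g i') v r"
    "length v + k \<le> l"
  shows "i = i'"
proof -
  have "g i = g i'" using assms(4-6) by (rule link_source_unique)
  then show ?thesis using assms(1-3) by (auto simp: lists_tagged_def bij_betw_def inj_on_def)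
qed

text \<open>The middle vertex of a composition carries the tag of the first letter of
  \<open>v\<close>, or that of \<open>r\<close> if \<open>v\<close> is empty. The last assumption
  makes this tag \<open>t\<close>, so summing over the listed vertices alone loses no
  composition.\<close>

lemma link_compose_listed:
  assumes "lists_tagged Y k t m g" "length u + j \<le> k" "length v + k \<le> l"
    and "t = (if v = [] then fst r else fst (hd v))"
  shows "(\<exists>i<m. link Y j k s u (g i) \<and> link Y k l (g i) v r) \<longleftrightarrow> link Y j l s (u @ v) r"
  unfolding link_compose[OF assms(2,3), symmetric]
proof (intro iffI; elim exE conjE)
  fix x assume x: "link Y j k s u x" "link Y k l x v r"
  have "x \<in> vert Y k ` sync Y k" "fst x = t"
    using link_source_vertex[OF x(2) assms(3)] link_source_tag[OF x(2)] assms(4) by simp_all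
  then obtain i where "i < m" "x = g i"
    using assms(1) unfolding lists_tagged_def bij_betw_def by blast
  then show "\<exists>i<m. link Y j k s u (g i) \<and> link Y k l (g i) v r" using x by blast
qed blast

context
  fixes Y :: "(int \<Rightarrow> 't \<times> 'a) set" and j k l n m p :: nat and t :: 't
    and f g h :: "nat \<Rightarrow> 't \<times> ('t \<times> 'a) list set"
  assumes tagged: "lists_tagged Y k t m g"
begin

text \<open>\<open>link_compose_listed\<close> gives the entries and
  \<open>lists_tagged_unique\<close> excludes repetitions. The length assumptions ask every label to
  be no longer than the number of levels it descends.\<close>

lemma sym_mult_link_mat:
  assumes "finite C" "finite D"
    and "\<And>c. c \<in> C \<Longrightarrow> length (\<gamma> c) + j \<le> k" "\<And>d. d \<in> D \<Longrightarrow> length (\<delta> d) + k \<le> l"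
    and "\<And>d i. d \<in> D \<Longrightarrow> i < p \<Longrightarrow> t = (if \<delta> d = [] then fst (h i) else fst (hd (\<delta> d)))"
  shows "sym_mult (link_mat Y j k C \<gamma> n m f g) (link_mat Y k l D \<delta> m p g h)
    = link_mat Y j l (C \<times> D) (\<lambda>(c, d). \<gamma> c @ \<delta> d) n p f h"
proof -
  let ?S = "\<lambda>i i'. {c \<in> C. link Y j k (f i) (\<gamma> c) (g i')}"
  let ?T = "\<lambda>i i'. {d \<in> D. link Y k l (g i) (\<delta> d) (h i')}"
  have "sym_mult (set_mat n m ?S) (set_mat m p ?T) = set_mat n p (\<lambda>i i'. \<Union>r<m. ?S i r \<times> ?T r i')"
  proof (rule sym_mult_set_mat)
    fix i i' r r' c d assume "r < m" "r' < m" "d \<in> ?T r i'" "d \<in> ?T r' i'"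
    then show "r = r'" using lists_tagged_unique[OF tagged] assms(4) by blast
  qed (use assms(1,2) in simp_all)
  also have "\<dots> = set_mat n p (\<lambda>i i'. {x \<in> C \<times> D. link Y j l (f i) (case x of (c, d) \<Rightarrow> \<gamma> c @ \<delta> d) (h i')})"
  proof (rule set_mat_cong)
    fix i i' assume i: "i < n" "i' < p"
    have "(\<exists>r<m. link Y j k (f i) (\<gamma> c) (g r) \<and> link Y k l (g r) (\<delta> d) (h i')) \<longleftrightarrow>
        link Y j l (f i) (\<gamma> c @ \<delta> d) (h i')" if "c \<in> C" "d \<in> D" for c d
      using link_compose_listed[OF tagged assms(3)[OF that(1)] assms(4)[OF that(2)] assms(5)[OF that(2) i(2)]] .
    then show "(\<Union>r<m. ?S i r \<times> ?T r i') =
        {x \<in> C \<times> D. link Y j l (f i) (case x of (c, d) \<Rightarrow> \<gamma> c @ \<delta> d) (h i')}" by auto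
  qed
  finally show ?thesis unfolding link_mat_def .
qed

lemma int_sym_mult_link_mat:
  assumes "finite D" "j \<le> k" "\<And>d. d \<in> D \<Longrightarrow> length (\<delta> d) + k \<le> l"
    and "\<And>d i. d \<in> D \<Longrightarrow> i < p \<Longrightarrow> t = (if \<delta> d = [] then fst (h i) else fst (hd (\<delta> d)))"
  shows "int_sym_mult (link_ind Y j k n m f g) (link_mat Y k l D \<delta> m p g h)
    = link_mat Y j l D \<delta> n p f h"
proof -
  let ?B = "\<lambda>i i'. link Y j k (f i) [] (g i')"
  let ?T = "\<lambda>i i'. {d \<in> D. link Y k l (g i) (\<delta> d) (h i')}"
  have "int_sym_mult (ind_mat n m ?B) (set_mat m p ?T)
    = set_mat n p (\<lambda>i i'. \<Union>r<m. if ?B i r then ?T r i' else {})"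
  proof (rule int_sym_mult_set_mat)
    fix i i' r r' d assume "r < m" "r' < m" "d \<in> ?T r i'" "d \<in> ?T r' i'"
    then show "r = r'" using lists_tagged_unique[OF tagged] assms(3) by blast
  qed (use assms(1) in simp_all)
  also have "\<dots> = set_mat n p (\<lambda>i i'. {d \<in> D. link Y j l (f i) (\<delta> d) (h i')})"
  proof (rule set_mat_cong)
    fix i i' assume i: "i < n" "i' < p"
    have "(\<exists>r<m. ?B i r \<and> link Y k l (g r) (\<delta> d) (h i')) \<longleftrightarrow>
        link Y j l (f i) (\<delta> d) (h i')" if "d \<in> D" for d
      using link_compose_listed[OF tagged _ assms(3)[OF that] assms(4)[OF that i(2)], of "[]"] assms(2)
      by simp
    then show "(\<Union>r<m. if ?B i r then ?T r i' else {}) = {d \<in> D. link Y j l (f i) (\<delta> d) (h i')}"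
      by (auto split: if_splits)
  qed
  finally show ?thesis unfolding link_mat_def link_ind_def .
qed

lemma sym_int_mult_link_mat:
  assumes "finite C" "k \<le> l" "\<And>c. c \<in> C \<Longrightarrow> length (\<gamma> c) + j \<le> k"
    and "\<And>i. i < p \<Longrightarrow> t = fst (h i)"
  shows "sym_int_mult (link_mat Y j k C \<gamma> n m f g) (link_ind Y k l m p g h)
    = link_mat Y j l C \<gamma> n p f h"
proof -
  let ?S = "\<lambda>i i'. {c \<in> C. link Y j k (f i) (\<gamma> c) (g i')}"
  let ?B = "\<lambda>i i'. link Y k l (g i) [] (h i')"
  have "sym_int_mult (set_mat n m ?S) (ind_mat m p ?B)
    = set_mat n p (\<lambda>i i'. \<Union>r<m. if ?B r i' then ?S i r else {})"
  proof (rule sym_int_mult_set_mat)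
    fix i i' r r' assume "r < m" "r' < m" "?B r i'" "?B r' i'"
    then show "r = r'" using lists_tagged_unique[OF tagged] assms(2) by simp
  qed (use assms(1) in simp_all)
  also have "\<dots> = set_mat n p (\<lambda>i i'. {c \<in> C. link Y j l (f i) (\<gamma> c) (h i')})"
  proof (rule set_mat_cong)
    fix i i' assume i: "i < n" "i' < p"
    have "(\<exists>r<m. link Y j k (f i) (\<gamma> c) (g r) \<and> ?B r i') \<longleftrightarrow>
        link Y j l (f i) (\<gamma> c) (h i')" if "c \<in> C" for c
      using link_compose_listed[OF tagged assms(3)[OF that], of "[]" l "h i'" "f i"] assms(2,4) i(2)
      by simp
    then show "(\<Union>r<m. if ?B r i' then ?S i r else {}) = {c \<in> C. link Y j l (f i) (\<gamma> c) (h i')}"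
      by (auto split: if_splits)
  qed
  finally show ?thesis unfolding link_mat_def link_ind_def .
qed

end

section \<open>Block codings\<close>

definition block :: "('a \<Rightarrow> 'c \<times> 'c) \<Rightarrow> bool \<Rightarrow> 'a \<Rightarrow> (bool \<times> 'c) list" where
  "block \<phi> s a = [(s, fst (\<phi> a)), (\<not> s, snd (\<phi> a))]"

definition encode :: "('a \<Rightarrow> 'c \<times> 'c) \<Rightarrow> bool \<Rightarrow> 'a list \<Rightarrow> (bool \<times> 'c) list" where
  "encode \<phi> s w = concat (map (block \<phi> s) w)"

lemma encode_simps [simp]:
  "encode \<phi> s [] = []"
  "encode \<phi> s (a # w) = (s, fst (\<phi> a)) # (\<not> s, snd (\<phi> a)) # encode \<phi> s w"
  "encode \<phi> s (u @ w) = encode \<phi> s u @ encode \<phi> s w"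
  by (simp_all add: encode_def block_def)

lemma length_encode [simp]: "length (encode \<phi> s w) = 2 * length w"
  by (induction w) simp_all

lemma encode_eq_Nil_iff [simp]: "encode \<phi> s w = [] \<longleftrightarrow> w = []"
  by (cases w) simp_all

lemma hd_encode: "w \<noteq> [] \<Longrightarrow> hd (encode \<phi> s w) = (s, fst (\<phi> (hd w)))"
  by (cases w) simp_all

lemma encode_inj:
  assumes "inj_on \<phi> A" "set v \<subseteq> A" "set w \<subseteq> A" "encode \<phi> s v = encode \<phi> s w"
  shows "v = w"
  using assms(2-4)
proof (induction v arbitrary: w)
  case Nil
  then have "encode \<phi> s w = []" by simp
  then show ?case by simp
next
  case (Cons a v)
  then obtain b w' where w: "w = b # w'" by (cases w) simp_all
  then have "\<phi> a = \<phi> b" "encode \<phi> s v = encode \<phi> s w'"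
    using Cons.prems(3) by (simp_all add: prod_eq_iff)
  then show ?case using Cons w assms(1) by (simp add: inj_on_def)
qed

text \<open>At the level of words, \<open>X\<close> arises from \<open>Y\<close> by cutting at the
  letters with tag \<open>s\<close> into blocks of two and reading each block as one symbol through
  \<open>\<phi>\<close>. The conditions linking \<open>X\<close> and \<open>Y\<close> concern finite
  words only, since vertices, edges and synchronization depend only on the language.
  \<open>tags\<close> says that tags alternate along a word.\<close>

locale block_coding =
  fixes A :: "'a set" and X :: "(int \<Rightarrow> 'a) set" and \<phi> :: "'a \<Rightarrow> 'c \<times> 'c" and s :: bool
    and Y :: "(int \<Rightarrow> bool \<times> 'c) set"
  assumes finite_A: "finite A" and inj_\<phi>: "inj_on \<phi> A"
    and symbols: "\<And>x i. x \<in> X \<Longrightarrow> x i \<in> A"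
    and lang_encode: "\<And>w. set w \<subseteq> A \<Longrightarrow> w \<noteq> [] \<Longrightarrow> encode \<phi> s w \<in> lang Y \<longleftrightarrow> w \<in> lang X"
    and even_word: "\<And>w. w \<in> lang Y \<Longrightarrow> fst (hd w) = s \<Longrightarrow> even (length w) \<Longrightarrow>
      \<exists>v. set v \<subseteq> A \<and> w = encode \<phi> s v"
    and tags: "\<And>w k. w \<in> lang Y \<Longrightarrow> k < length w \<Longrightarrow> fst (w ! k) = (fst (hd w) = even k)"
begin

abbreviation enc where "enc \<equiv> encode \<phi> s"

lemma word_symbols: "w \<in> lang X \<Longrightarrow> set w \<subseteq> A"
  using symbols by (auto simp: lang_def in_set_conv_nth)

lemma enc_lang: "w \<in> lang X \<Longrightarrow> enc w \<in> lang Y"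
  using lang_encode[of w] word_symbols lang_nonempty by blast

lemma decode_word:
  assumes "w \<in> lang Y" "fst (hd w) = s" "even (length w)"
  obtains v where "v \<in> lang X" "w = enc v"
proof -
  obtain v where v: "set v \<subseteq> A" "w = enc v" using even_word[OF assms] by blast
  then have "v \<noteq> []" using lang_nonempty[OF assms(1)] by auto
  then show ?thesis using that[of v] v lang_encode[of v] assms(1) by simp
qed

text \<open>A word of odd length ends inside a block; one more letter on the right completes
  it.\<close>

lemma decode_word':
  assumes "w \<in> lang Y" "fst (hd w) = s"
  obtains v b where "v \<in> lang X" "enc v = w @ b"
proof (cases "even (length w)")
  case True
  then show ?thesis using decode_word[OF assms] that[of _ "[]"] by auto
next
  case False
  obtain b where b: "w @ [b] \<in> lang Y" using lang_extend_right[OF assms(1)] by blast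
  moreover have "fst (hd (w @ [b])) = s" using assms(2) lang_nonempty[OF assms(1)] by simp
  moreover have "even (length (w @ [b]))" using False by simp
  ultimately show ?thesis using decode_word that[of _ "[b]"] by metis
qed

lemma encode_tag: "\<mu> \<noteq> [] \<Longrightarrow> fst (hd (enc \<mu>)) = s"
  by (simp add: hd_encode)

text \<open>Because tags alternate, a past of even length begins with the same tag as the encoded
  word behind it. It is therefore cut into whole blocks and decodes to a past of half the
  length.\<close>

lemma pasts_enc:
  assumes "\<mu> \<in> lang X"
  shows "pasts Y (2 * l) (enc \<mu>) = enc ` pasts X l \<mu>"
proof (intro equalityI subsetI)
  fix c assume "c \<in> pasts Y (2 * l) (enc \<mu>)"
  then have c: "length c = 2 * l" "c @ enc \<mu> \<in> lang Y" by (auto simp: pasts_def)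
  have \<mu>: "\<mu> \<noteq> []" using assms by (rule lang_nonempty)
  then have "fst ((c @ enc \<mu>) ! (2 * l)) = s"
    using c(1) by (simp add: nth_append hd_conv_nth[symmetric] encode_tag)
  then have "fst (hd (c @ enc \<mu>)) = s"
    using tags[OF c(2), of "2 * l"] c(1) \<mu> by (cases s) simp_all
  then obtain v where v: "v \<in> lang X" "c @ enc \<mu> = enc v"
    using decode_word[OF c(2)] c(1) by auto
  have "enc (take l v) @ enc (drop l v) = c @ enc \<mu>"
    unfolding v(2) encode_simps(3)[symmetric] by simp
  moreover have "length v = l + length \<mu>" using arg_cong[OF v(2), of length] c(1) by simp
  ultimately have eq: "enc (take l v) = c" "enc (drop l v) = enc \<mu>"
    using c(1) by simp_all
  have "set v \<subseteq> A" "set \<mu> \<subseteq> A" using word_symbols v(1) assms by blast+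
  then have "drop l v = \<mu>"
    using encode_inj[OF inj_\<phi> _ _ eq(2)] set_drop_subset[of l v] by blast
  then have "take l v \<in> pasts X l \<mu>"
    using v(1) \<open>length v = l + length \<mu>\<close> append_take_drop_id[of l v] by (simp add: pasts_def)
  then show "c \<in> enc ` pasts X l \<mu>" using eq(1) by blast
next
  fix c assume "c \<in> enc ` pasts X l \<mu>"
  then obtain b where b: "c = enc b" "length b = l" "b @ \<mu> \<in> lang X" by (auto simp: pasts_def)
  then show "c \<in> pasts Y (2 * l) (enc \<mu>)" using enc_lang[OF b(3)] by (simp add: pasts_def)
qed

lemma pasts_enc_eq_iff:
  assumes "\<mu> \<in> lang X" "\<nu> \<in> lang X"
  shows "pasts Y (2 * l) (enc \<mu>) = pasts Y (2 * l) (enc \<nu>) \<longleftrightarrow> pasts X l \<mu> = pasts X l \<nu>"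
proof -
  have "inj_on enc {w. set w \<subseteq> A}"
    by (rule inj_onI) (use encode_inj[OF inj_\<phi>] in auto)
  moreover have "pasts X l \<kappa> \<subseteq> {w. set w \<subseteq> A}" for \<kappa>
    using word_symbols[of "_ @ \<kappa>"] by (fastforce simp: pasts_def)
  ultimately show ?thesis
    unfolding pasts_enc[OF assms(1)] pasts_enc[OF assms(2)] by (intro inj_on_image_eq_iff) auto
qed

lemma vert_enc_eq_iff:
  assumes "\<mu> \<in> lang X" "\<nu> \<in> lang X"
  shows "vert Y (2 * l) (enc \<mu>) = vert Y (2 * l) (enc \<nu>) \<longleftrightarrow> pasts X l \<mu> = pasts X l \<nu>"
  using pasts_enc_eq_iff[OF assms] lang_nonempty[OF assms(1)] lang_nonempty[OF assms(2)]
  by (simp add: vert_def encode_tag)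

text \<open>A continuation of \<open>enc \<mu>\<close> in \<open>Y\<close> may stop inside a block,
  so it is first completed to an encoded word.\<close>

lemma sync_enc_iff:
  assumes "\<mu> \<in> lang X"
  shows "enc \<mu> \<in> sync Y (2 * l) \<longleftrightarrow> \<mu> \<in> sync X l"
proof
  assume h: "enc \<mu> \<in> sync Y (2 * l)"
  show "\<mu> \<in> sync X l" unfolding sync_iff
  proof (intro conjI allI impI)
    fix c assume c: "\<mu> @ c \<in> lang X"
    then have "enc \<mu> @ enc c \<in> lang Y" using enc_lang[OF c] by simp
    then have "pasts Y (2 * l) (enc \<mu> @ enc c) = pasts Y (2 * l) (enc \<mu>)"
      using h by (simp add: sync_iff)
    then show "pasts X l (\<mu> @ c) = pasts X l \<mu>"
      using pasts_enc_eq_iff[OF c assms] by simp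
  qed (rule assms)
next
  assume h: "\<mu> \<in> sync X l"
  have \<mu>: "\<mu> \<noteq> []" using assms by (rule lang_nonempty)
  show "enc \<mu> \<in> sync Y (2 * l)" unfolding sync_iff
  proof (intro conjI allI impI)
    fix c assume c: "enc \<mu> @ c \<in> lang Y"
    have "fst (hd (enc \<mu> @ c)) = s" using encode_tag[OF \<mu>] \<mu> by simp
    then obtain v b where v: "v \<in> lang X" "enc v = (enc \<mu> @ c) @ b"
      using decode_word'[OF c] by blast
    have len: "length v \<ge> length \<mu>" using arg_cong[OF v(2), of length] by simp
    have "enc (take (length \<mu>) v) @ enc (drop (length \<mu>) v) = enc \<mu> @ c @ b"
      unfolding encode_simps(3)[symmetric] using v(2) by simp
    then have eq: "enc (take (length \<mu>) v) = enc \<mu>" "enc (drop (length \<mu>) v) = c @ b"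
      using len by simp_all
    have "set v \<subseteq> A" "set \<mu> \<subseteq> A" using word_symbols v(1) assms by blast+
    then have "take (length \<mu>) v = \<mu>"
      using encode_inj[OF inj_\<phi> _ _ eq(1)] set_take_subset[of "length \<mu>" v] by blast
    then obtain d where d: "v = \<mu> @ d" by (metis append_take_drop_id)
    have "pasts X l (\<mu> @ d) = pasts X l \<mu>" using h v(1) d by (simp add: sync_iff)
    then have *: "pasts Y (2 * l) (enc v) = pasts Y (2 * l) (enc \<mu>)"
      using pasts_enc_eq_iff[OF v(1) assms] d by simp
    \<comment> \<open>Pasts shrink along \<open>enc \<mu>\<close>, \<open>enc \<mu> @ c\<close> and
      \<open>enc \<mu> @ c @ b\<close>, and the two outer sets agree by \<open>*\<close>; hence the
      middle one equals both.\<close>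
    have "pasts Y k (w @ r) \<subseteq> pasts Y k w" if "w \<noteq> []" for k w r
      using lang_prefix[of _ r Y] that by (fastforce simp: pasts_def)
    from this[of "enc \<mu>" "2 * l" c] this[of "enc \<mu> @ c" "2 * l" b] \<mu>
    show "pasts Y (2 * l) (enc \<mu> @ c) = pasts Y (2 * l) (enc \<mu>)"
      using * unfolding v(2) by simp
  qed (rule enc_lang[OF assms])
qed

text \<open>Completing the last block does not change the pasts of a synchronizing word, so every
  vertex with tag \<open>s\<close> has an encoded representative.\<close>

lemma sync_decode:
  assumes "w \<in> sync Y (2 * l)" "fst (hd w) = s"
  obtains \<mu> b where "\<mu> \<in> sync X l" "enc \<mu> = w @ b" "vert Y (2 * l) w = vert Y (2 * l) (enc \<mu>)"
proof -
  have w: "w \<in> lang Y" using assms(1) by (rule sync_lang)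
  obtain v b where v: "v \<in> lang X" "enc v = w @ b" by (rule decode_word'[OF w assms(2)])
  have wb: "w @ b \<in> lang Y" using enc_lang[OF v(1)] v(2) by simp
  have "v \<in> sync X l"
    using sync_enc_iff[OF v(1)] sync_append_right[OF assms(1) wb] v(2) by simp
  moreover have "vert Y (2 * l) w = vert Y (2 * l) (enc v)"
    using assms(1) wb lang_nonempty[OF w] unfolding v(2) by (simp add: sync_iff vert_def)
  ultimately show ?thesis using that v(2) by blast
qed

text \<open>The level doubles because one symbol of \<open>X\<close> is two letters of
  \<open>Y\<close>. The choice of the representative does not affect the value, by
  \<open>embed_past_class\<close>.\<close>

definition embed :: "nat \<Rightarrow> 'a list set \<Rightarrow> bool \<times> (bool \<times> 'c) list set" where
  "embed l U = vert Y (2 * l) (enc (SOME \<mu>. \<mu> \<in> sync X l \<and> U = past_class X l \<mu>))"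

lemma embed_past_class:
  assumes "\<mu> \<in> sync X l"
  shows "embed l (past_class X l \<mu>) = vert Y (2 * l) (enc \<mu>)"
proof -
  define \<nu> where "\<nu> = (SOME \<nu>. \<nu> \<in> sync X l \<and> past_class X l \<mu> = past_class X l \<nu>)"
  have "\<nu> \<in> sync X l \<and> past_class X l \<mu> = past_class X l \<nu>"
    unfolding \<nu>_def by (rule someI[of _ \<mu>]) (simp add: assms)
  then have "vert Y (2 * l) (enc \<nu>) = vert Y (2 * l) (enc \<mu>)"
    using assms vert_enc_eq_iff past_class_eq_iff sync_lang by metis
  then show ?thesis by (simp add: embed_def \<nu>_def)
qed

lemma embed_eq_iff:
  assumes "\<mu> \<in> sync X l" "U \<in> lambda_vertices X l"
  shows "embed l U = vert Y (2 * l) (enc \<mu>) \<longleftrightarrow> U = past_class X l \<mu>"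
proof -
  obtain \<nu> where "\<nu> \<in> sync X l" "U = past_class X l \<nu>"
    using assms(2) by (auto simp: lambda_vertices_def)
  then show ?thesis
    using assms(1) vert_enc_eq_iff past_class_eq_iff sync_lang embed_past_class by metis
qed

lemma bij_betw_embed:
  "bij_betw (embed l) (lambda_vertices X l) {v \<in> vert Y (2 * l) ` sync Y (2 * l). fst v = s}"
  unfolding bij_betw_def
proof (intro conjI)
  show "inj_on (embed l) (lambda_vertices X l)"
  proof (rule inj_onI)
    fix U V assume h: "U \<in> lambda_vertices X l" "V \<in> lambda_vertices X l" "embed l U = embed l V"
    obtain \<mu> where \<mu>: "\<mu> \<in> sync X l" "V = past_class X l \<mu>"
      using h(2) by (auto simp: lambda_vertices_def)
    then show "U = V" using h(3) embed_eq_iff[OF \<mu>(1) h(1)] embed_past_class[OF \<mu>(1)] by simp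
  qed
  show "embed l ` lambda_vertices X l = {v \<in> vert Y (2 * l) ` sync Y (2 * l). fst v = s}"
  proof (intro equalityI subsetI)
    fix v assume "v \<in> embed l ` lambda_vertices X l"
    then obtain \<mu> where \<mu>: "\<mu> \<in> sync X l" "v = vert Y (2 * l) (enc \<mu>)"
      by (auto simp: lambda_vertices_def embed_past_class)
    then have "\<mu> \<in> lang X" "\<mu> \<noteq> []" using sync_lang lang_nonempty by blast+
    then show "v \<in> {v \<in> vert Y (2 * l) ` sync Y (2 * l). fst v = s}"
      using \<mu> sync_enc_iff encode_tag by (auto simp: vert_def)
  next
    fix v assume "v \<in> {v \<in> vert Y (2 * l) ` sync Y (2 * l). fst v = s}"
    then obtain w where w: "w \<in> sync Y (2 * l)" "fst (hd w) = s" "v = vert Y (2 * l) w"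
      by (auto simp: vert_def)
    obtain \<mu> b where \<mu>: "\<mu> \<in> sync X l" "vert Y (2 * l) w = vert Y (2 * l) (enc \<mu>)"
      by (rule sync_decode[OF w(1,2)]) blast
    then have "v = embed l (past_class X l \<mu>)" using w(3) embed_past_class by simp
    then show "v \<in> embed l ` lambda_vertices X l" using \<mu>(1) by (auto simp: lambda_vertices_def)
  qed
qed

lemma embed_tag: "U \<in> lambda_vertices X l \<Longrightarrow> fst (embed l U) = s"
  using bij_betw_apply[OF bij_betw_embed] by blast

text \<open>The word representing the target vertex may be replaced by an encoded one:
  \<open>enc u\<close> has at most 2 * m letters, and the two words have the same pasts of length 2
  * m.\<close>

lemma link_embed_iff:
  assumes "V \<in> lambda_vertices X m" "set u \<subseteq> A" "length u + k \<le> m"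
  shows "link Y (2 * k) (2 * m) x (enc u) (embed m V) \<longleftrightarrow>
    (\<exists>\<nu>\<in>sync X m. u @ \<nu> \<in> lang X \<and> x = vert Y (2 * k) (enc (u @ \<nu>)) \<and> V = past_class X m \<nu>)"
proof
  assume "link Y (2 * k) (2 * m) x (enc u) (embed m V)"
  then obtain w where w: "w \<in> sync Y (2 * m)" "enc u @ w \<in> lang Y"
    "x = vert Y (2 * k) (enc u @ w)" "embed m V = vert Y (2 * m) w"
    unfolding link_def by blast
  have "fst (hd w) = s" using embed_tag[OF assms(1)] w(4) by (simp add: vert_def)
  then obtain \<nu> where \<nu>: "\<nu> \<in> sync X m" "vert Y (2 * m) w = vert Y (2 * m) (enc \<nu>)"
    using sync_decode[OF w(1)] by metis
  have lw: "w \<in> lang Y" using w(1) by (rule sync_lang)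
  have l\<nu>: "\<nu> \<in> lang X" using \<nu>(1) by (rule sync_lang)
  have "enc u @ enc \<nu> \<in> lang Y"
    using lang_append_cong[OF _ lw enc_lang[OF l\<nu>], of "2 * m" "enc u"] \<nu>(2) w(2) assms(3)
    by (simp add: vert_def)
  moreover have "set (u @ \<nu>) \<subseteq> A" using assms(2) word_symbols[OF l\<nu>] by simp
  ultimately have "u @ \<nu> \<in> lang X"
    using lang_encode[of "u @ \<nu>"] lang_nonempty[OF l\<nu>] by simp
  moreover have "x = vert Y (2 * k) (enc (u @ \<nu>))"
    using vert_append_cong[OF \<nu>(2) lw enc_lang[OF l\<nu>], of "enc u" "2 * k"] assms(3) w(3) by simp
  moreover have "V = past_class X m \<nu>"
    using embed_eq_iff[OF \<nu>(1) assms(1)] w(4) \<nu>(2) by simp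
  ultimately show "\<exists>\<nu>\<in>sync X m. u @ \<nu> \<in> lang X \<and> x = vert Y (2 * k) (enc (u @ \<nu>)) \<and>
    V = past_class X m \<nu>" using \<nu>(1) by blast
next
  assume "\<exists>\<nu>\<in>sync X m. u @ \<nu> \<in> lang X \<and> x = vert Y (2 * k) (enc (u @ \<nu>)) \<and> V = past_class X m \<nu>"
  then obtain \<nu> where \<nu>: "\<nu> \<in> sync X m" "u @ \<nu> \<in> lang X" "x = vert Y (2 * k) (enc (u @ \<nu>))"
    "V = past_class X m \<nu>" by blast
  have "enc \<nu> \<in> sync Y (2 * m)" using sync_enc_iff[OF sync_lang[OF \<nu>(1)]] \<nu>(1) by simp
  moreover have "enc u @ enc \<nu> \<in> lang Y" using enc_lang[OF \<nu>(2)] by simp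
  ultimately show "link Y (2 * k) (2 * m) x (enc u) (embed m V)"
    unfolding link_def using \<nu>(3,4) embed_past_class[OF \<nu>(1)] by auto
qed

lemma lambda_edges_eq_link:
  assumes "U \<in> lambda_vertices X l" "V \<in> lambda_vertices X (Suc l)"
  shows "{a. (U, a, V) \<in> lambda_edges X l} =
    {a \<in> A. link Y (2 * l) (2 * Suc l) (embed l U) (block \<phi> s a) (embed (Suc l) V)}"
proof -
  have edge: "(U, a, V) \<in> lambda_edges X l \<longleftrightarrow>
      (\<exists>\<nu>\<in>sync X (Suc l). a # \<nu> \<in> lang X \<and> U = past_class X l (a # \<nu>) \<and> V = past_class X (Suc l) \<nu>)"
    for a
  proof -
    have "[a] \<in> Gamma_minus X 1 \<nu> \<longleftrightarrow> a # \<nu> \<in> lang X" if "\<nu> \<in> sync X (Suc l)" for \<nu>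
      using Gamma_minus_eq_pasts[OF _ sync_lang[OF that], of 1] by (simp add: pasts_def)
    then show ?thesis unfolding lambda_edges_def by blast
  qed
  have "(U, a, V) \<in> lambda_edges X l \<longleftrightarrow>
      link Y (2 * l) (2 * Suc l) (embed l U) (block \<phi> s a) (embed (Suc l) V)" if a: "a \<in> A" for a
  proof -
    have "a # \<nu> \<in> sync X l" if "\<nu> \<in> sync X (Suc l)" "a # \<nu> \<in> lang X" for \<nu>
      using sync_append_left[of \<nu> X "Suc l" "[a]" l] that by simp
    then have "embed l U = vert Y (2 * l) (enc (a # \<nu>)) \<longleftrightarrow> U = past_class X l (a # \<nu>)"
      if "\<nu> \<in> sync X (Suc l)" "a # \<nu> \<in> lang X" for \<nu>
      using that embed_eq_iff[OF _ assms(1)] by blast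
    moreover have "block \<phi> s a = enc [a]" by (simp add: block_def)
    ultimately show ?thesis
      unfolding edge using link_embed_iff[OF assms(2), of "[a]" l "embed l U"] a
      by (simp del: encode_simps) metis
  qed
  moreover have "a \<in> A" if "(U, a, V) \<in> lambda_edges X l" for a
    using that edge[of a] word_symbols by fastforce
  ultimately show ?thesis by blast
qed

lemma lambda_iota_iff_link:
  assumes "U \<in> lambda_vertices X l" "V \<in> lambda_vertices X (Suc l)"
  shows "lambda_iota X l V = U \<longleftrightarrow>
    link Y (2 * l) (2 * Suc l) (embed l U) [] (embed (Suc l) V)"
proof -
  obtain \<mu> where \<mu>: "\<mu> \<in> sync X (Suc l)" "V = past_class X (Suc l) \<mu>"
    using assms(2) by (auto simp: lambda_vertices_def)
  have "link Y (2 * l) (2 * Suc l) (embed l U) [] (embed (Suc l) V) \<longleftrightarrow>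
    (\<exists>\<nu>\<in>sync X (Suc l). embed l U = vert Y (2 * l) (enc \<nu>) \<and> V = past_class X (Suc l) \<nu>)"
    using link_embed_iff[OF assms(2), of "[]" l "embed l U"] sync_lang by fastforce
  also have "\<dots> \<longleftrightarrow> (\<exists>\<nu>\<in>sync X (Suc l). U = lambda_iota X l V \<and> V = past_class X (Suc l) \<nu>)"
    using embed_eq_iff[OF sync_mono assms(1)] lambda_iota_past_class by fastforce
  also have "\<dots> \<longleftrightarrow> lambda_iota X l V = U" using \<mu> by blast
  finally show ?thesis by blast
qed

text \<open>Words of \<open>Y\<close> need not be aligned with blocks, so they are enlarged on both
  sides to encoded words before the property of \<open>X\<close> applies. Conversely, a
  synchronizing continuation in \<open>Y\<close> is exchanged for an encoded word with the same long
  pasts.\<close>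

lemma lambda_synchronizing_iff: "lambda_synchronizing X \<longleftrightarrow> lambda_synchronizing Y"
proof
  assume ls: "lambda_synchronizing X"
  show "lambda_synchronizing Y" unfolding lambda_synchronizing_def
  proof (intro ballI allI impI)
    fix w and k :: nat assume w: "w \<in> lang Y" and k: "1 \<le> k"
    have w0: "w \<noteq> []" using w by (rule lang_nonempty)
    obtain a where a: "a @ w \<in> lang Y" "fst (hd (a @ w)) = s"
    proof (cases "fst (hd w) = s")
      case True
      then show ?thesis using that[of "[]"] w by simp
    next
      case False
      obtain b where b: "b # w \<in> lang Y" using lang_extend_left[OF w] by blast
      have "fst (hd w) \<longleftrightarrow> \<not> fst b"
        using tags[OF b, of 1] w0 by (simp add: hd_conv_nth)
      then show ?thesis using that[of "[b]"] b False by auto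
    qed
    obtain v r where v: "v \<in> lang X" "enc v = (a @ w) @ r" by (rule decode_word'[OF a])
    \<comment> \<open>The extra length r levels pay for prepending to \<open>enc \<nu>\<close> the
      remainder \<open>r\<close> of the last block of \<open>v\<close>; level k is left.\<close>
    obtain \<nu> where \<nu>: "\<nu> \<in> sync X (k + length r)" "\<nu> \<in> Gamma_plus X v"
      using ls v(1) k unfolding lambda_synchronizing_def by (meson IntD1 IntD2 trans_le_add1)
    then have "v @ \<nu> \<in> lang X" by (simp add: Gamma_plus_def)
    from enc_lang[OF this] have awr: "a @ w @ r @ enc \<nu> \<in> lang Y" using v(2) by simp
    have wr: "w @ r @ enc \<nu> \<in> lang Y" by (rule lang_suffix[OF awr]) (simp add: w0)
    have "\<nu> \<noteq> []" using \<nu>(1) sync_lang lang_nonempty by blast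
    then have r: "r @ enc \<nu> \<in> lang Y" by (intro lang_suffix[OF wr]) simp
    have "enc \<nu> \<in> sync Y (2 * (k + length r))"
      using sync_enc_iff[OF sync_lang[OF \<nu>(1)]] \<nu>(1) by (simp only:)
    then have "r @ enc \<nu> \<in> sync Y k"
      using r by (rule sync_append_left) simp
    then show "\<exists>v. v \<in> sync Y k \<inter> Gamma_plus Y w"
      using r wr unfolding Gamma_plus_def by blast
  qed
next
  assume ls: "lambda_synchronizing Y"
  show "lambda_synchronizing X" unfolding lambda_synchronizing_def
  proof (intro ballI allI impI)
    fix \<mu> and k :: nat assume \<mu>: "\<mu> \<in> lang X" and k: "1 \<le> k"
    \<comment> \<open>Level 2 * m exceeds the length of \<open>enc \<mu>\<close>, so that
      \<open>w\<close> can be exchanged for an encoded word behind \<open>enc \<mu>\<close>.\<close>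
    define m where "m = k + length \<mu>"
    have "1 \<le> 2 * m" using k by (simp add: m_def)
    then obtain w where w: "w \<in> sync Y (2 * m)" "w \<in> Gamma_plus Y (enc \<mu>)"
      using ls enc_lang[OF \<mu>] unfolding lambda_synchronizing_def by (meson IntD1 IntD2)
    have \<mu>w: "enc \<mu> @ w \<in> lang Y" and lw: "w \<in> lang Y" using w(2) by (simp_all add: Gamma_plus_def)
    have \<mu>0: "\<mu> \<noteq> []" using \<mu> by (rule lang_nonempty)
    have "fst (hd w) = s"
      using tags[OF \<mu>w, of "2 * length \<mu>"] lang_nonempty[OF lw] encode_tag[OF \<mu>0] \<mu>0
      by (simp add: hd_append nth_append hd_conv_nth)
    then obtain \<nu> where \<nu>: "\<nu> \<in> sync X m" "vert Y (2 * m) w = vert Y (2 * m) (enc \<nu>)"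
      using sync_decode[OF w(1)] by metis
    have l\<nu>: "\<nu> \<in> lang X" using \<nu>(1) by (rule sync_lang)
    have "enc \<mu> @ enc \<nu> \<in> lang Y"
      using lang_append_cong[OF _ lw enc_lang[OF l\<nu>], of "2 * m" "enc \<mu>"] \<nu>(2) \<mu>w
      by (simp add: vert_def m_def)
    then have "\<mu> @ \<nu> \<in> lang X"
      using lang_encode[of "\<mu> @ \<nu>"] word_symbols[OF l\<nu>] word_symbols[OF \<mu>] \<mu>0 by simp
    moreover have "\<nu> \<in> sync X k" using \<nu>(1) by (rule sync_mono) (simp add: m_def)
    ultimately show "\<exists>v. v \<in> sync X k \<inter> Gamma_plus X \<mu>"
      using l\<nu> unfolding Gamma_plus_def by blast
  qed
qed

end

section \<open>The matrices of \<open>X\<close> as matrices of links in \<open>Y\<close>\<close>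

lemma link_mat_carrier [simp]: "link_mat Y j k C \<gamma> n m f g \<in> carrier_mat n m"
  by (simp add: link_mat_def)

lemma link_ind_carrier [simp]: "link_ind Y j k n m f g \<in> carrier_mat n m"
  by (simp add: link_ind_def ind_mat_def)

lemma symbolic_matrix_over_link_mat: "symbolic_matrix_over C (link_mat Y j k C \<gamma> n m f g)"
  unfolding link_mat_def by (rule symbolic_matrix_over_set_mat) blast

context block_coding
begin

definition size_at :: "nat \<Rightarrow> nat" where
  "size_at l = card (lambda_vertices X l)"

context
  fixes e :: "nat \<Rightarrow> nat \<Rightarrow> 'a list set"
  assumes enum: "vertex_enumeration X e"
begin

definition vertex_at :: "nat \<Rightarrow> nat \<Rightarrow> bool \<times> (bool \<times> 'c) list set" where
  "vertex_at l i = embed l (e l i)"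

lemma bij_betw_enum: "bij_betw (e l) {..<size_at l} (lambda_vertices X l)"
  using enum unfolding vertex_enumeration_def size_at_def by blast

lemma enum_vertex: "i < size_at l \<Longrightarrow> e l i \<in> lambda_vertices X l"
  using bij_betw_apply[OF bij_betw_enum] by blast

lemma lists_tagged_vertex_at: "lists_tagged Y (2 * l) s (size_at l) (vertex_at l)"
  unfolding lists_tagged_def vertex_at_def
  using bij_betw_trans[OF bij_betw_enum bij_betw_embed] by (simp add: comp_def)

lemma sms_M_eq_link_mat:
  "sms_M (lambda_sms A X e) l = link_mat Y (2 * l) (2 * Suc l) A (block \<phi> s)
    (size_at l) (size_at (Suc l)) (vertex_at l) (vertex_at (Suc l))"
proof -
  have "sms_M (lambda_sms A X e) l =
    set_mat (size_at l) (size_at (Suc l)) (\<lambda>i j. {a. (e l i, a, e (Suc l) j) \<in> lambda_edges X l})"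
    by (simp add: lambda_sms_def set_mat_def size_at_def)
  also have "\<dots> = link_mat Y (2 * l) (2 * Suc l) A (block \<phi> s)
    (size_at l) (size_at (Suc l)) (vertex_at l) (vertex_at (Suc l))"
    unfolding link_mat_def vertex_at_def
    by (rule set_mat_cong) (rule lambda_edges_eq_link[OF enum_vertex enum_vertex])
  finally show ?thesis .
qed

lemma sms_I_eq_link_ind:
  "sms_I (lambda_sms A X e) l = link_ind Y (2 * l) (2 * Suc l)
    (size_at l) (size_at (Suc l)) (vertex_at l) (vertex_at (Suc l))"
proof (rule eq_matI, goal_cases)
  case (1 i j)
  then have ij: "i < size_at l" "j < size_at (Suc l)" by (simp_all add: link_ind_def ind_mat_def)
  then show ?case
    using lambda_iota_iff_link[OF enum_vertex[OF ij(1)] enum_vertex[OF ij(2)]]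
    by (simp add: lambda_sms_def link_ind_def ind_mat_def vertex_at_def size_at_def)
qed (simp_all add: lambda_sms_def link_ind_def ind_mat_def size_at_def)

lemma sms_size_lambda_sms: "sms_size (lambda_sms A X e) l = size_at l"
  by (simp add: lambda_sms_def size_at_def)

text \<open>Both \<open>I M\<close> and \<open>M I\<close> descend two levels of \<open>X\<close>,
  that is four levels of \<open>Y\<close>, while reading one block. They are the same link matrix,
  which is the commutation relation of a symbolic matrix system.\<close>

lemma int_sym_mult_I_M:
  "int_sym_mult (sms_I (lambda_sms A X e) l) (sms_M (lambda_sms A X e) (Suc l)) =
    link_mat Y (2 * l) (2 * Suc (Suc l)) A (block \<phi> s)
      (size_at l) (size_at (Suc (Suc l))) (vertex_at l) (vertex_at (Suc (Suc l)))"
  unfolding sms_M_eq_link_mat sms_I_eq_link_ind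
  by (rule int_sym_mult_link_mat[OF lists_tagged_vertex_at]) (simp_all add: finite_A block_def)

lemma sym_int_mult_M_I:
  "sym_int_mult (sms_M (lambda_sms A X e) l) (sms_I (lambda_sms A X e) (Suc l)) =
    link_mat Y (2 * l) (2 * Suc (Suc l)) A (block \<phi> s)
      (size_at l) (size_at (Suc (Suc l))) (vertex_at l) (vertex_at (Suc (Suc l)))"
  unfolding sms_M_eq_link_mat sms_I_eq_link_ind
  by (rule sym_int_mult_link_mat[OF lists_tagged_vertex_at])
    (simp_all add: finite_A block_def link_target_tag[OF lists_tagged_vertex_at])

lemma symbolic_matrix_system_lambda_sms:
  assumes "lambda_synchronizing X"
  shows "symbolic_matrix_system (lambda_sms A X e)"
  unfolding symbolic_matrix_system_def
proof (intro conjI allI impI)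
  show "finite (sms_alphabet (lambda_sms A X e))" by (simp add: lambda_sms_def finite_A)
next
  fix l
  show "sms_M (lambda_sms A X e) l \<in>
      carrier_mat (sms_size (lambda_sms A X e) l) (sms_size (lambda_sms A X e) (l + 1))"
    and "sms_I (lambda_sms A X e) l \<in>
      carrier_mat (sms_size (lambda_sms A X e) l) (sms_size (lambda_sms A X e) (l + 1))"
    by (simp_all add: lambda_sms_def)
  show "symbolic_matrix_over (sms_alphabet (lambda_sms A X e)) (sms_M (lambda_sms A X e) l)"
    unfolding sms_M_eq_link_mat by (simp add: symbolic_matrix_over_link_mat lambda_sms_def)
  show "int_sym_mult (sms_I (lambda_sms A X e) l) (sms_M (lambda_sms A X e) (l + 1)) =
      sym_int_mult (sms_M (lambda_sms A X e) l) (sms_I (lambda_sms A X e) (l + 1))"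
    by (simp add: int_sym_mult_I_M sym_int_mult_M_I)
next
  fix l i j assume "i < sms_size (lambda_sms A X e) l" "j < sms_size (lambda_sms A X e) (l + 1)"
  then show "sms_I (lambda_sms A X e) l $$ (i, j) \<in> {0, 1}" by (simp add: lambda_sms_def)
next
  fix l i assume i: "i < sms_size (lambda_sms A X e) l"
  then obtain \<mu> where \<mu>: "\<mu> \<in> sync X l" "e l i = past_class X l \<mu>"
    using enum_vertex unfolding sms_size_lambda_sms lambda_vertices_def by blast
  have l\<mu>: "\<mu> \<in> lang X" using \<mu>(1) by (rule sync_lang)
  \<comment> \<open>No row of \<open>I\<close> is zero, by \<lambda>-synchronization: a continuation
    \<open>\<nu>\<close> of high enough level makes \<open>\<mu> @ \<nu>\<close> synchronize at
    level Suc l, and its class at level l is still that of \<open>\<mu>\<close>.\<close>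
  have "1 \<le> Suc l + length \<mu>" by simp
  then obtain \<nu> where \<nu>: "\<nu> \<in> sync X (Suc l + length \<mu>)" "\<nu> \<in> Gamma_plus X \<mu>"
    using assms l\<mu> unfolding lambda_synchronizing_def by (meson IntD1 IntD2)
  have \<mu>\<nu>: "\<mu> @ \<nu> \<in> lang X" using \<nu>(2) by (simp add: Gamma_plus_def)
  have sy: "\<mu> @ \<nu> \<in> sync X (Suc l)" by (rule sync_append_left[OF \<nu>(1) \<mu>\<nu>]) simp
  have "past_class X l (\<mu> @ \<nu>) = e l i"
    using past_class_eq_iff[OF \<mu>\<nu> l\<mu>] \<mu> \<mu>\<nu> by (simp add: sync_iff)
  then have "lambda_iota X l (past_class X (Suc l) (\<mu> @ \<nu>)) = e l i"
    using lambda_iota_past_class[OF sy] by simp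
  moreover have "past_class X (Suc l) (\<mu> @ \<nu>) \<in> lambda_vertices X (Suc l)"
    using sy by (simp add: lambda_vertices_def)
  then obtain j where "j < size_at (Suc l)" "past_class X (Suc l) (\<mu> @ \<nu>) = e (Suc l) j"
    using bij_betw_enum[of "Suc l"] unfolding bij_betw_def by blast
  ultimately show "\<exists>j<sms_size (lambda_sms A X e) (l + 1). sms_I (lambda_sms A X e) l $$ (i, j) \<noteq> 0"
    using i by (intro exI[of _ j]) (simp add: lambda_sms_def size_at_def)
next
  fix l j assume j: "j < sms_size (lambda_sms A X e) (l + 1)"
  then have "e (Suc l) j \<in> lambda_vertices X (Suc l)"
    using enum_vertex unfolding sms_size_lambda_sms by simp
  then obtain \<mu> where \<mu>: "\<mu> \<in> sync X (Suc l)" "e (Suc l) j = past_class X (Suc l) \<mu>"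
    unfolding lambda_vertices_def by blast
  have "\<mu> \<in> sync X l" using \<mu>(1) by (rule sync_mono) simp
  then have "lambda_iota X l (e (Suc l) j) \<in> lambda_vertices X l"
    using lambda_iota_past_class[OF \<mu>(1)] \<mu>(2) by (simp add: lambda_vertices_def)
  then obtain i where i: "i < size_at l" "e l i = lambda_iota X l (e (Suc l) j)"
    using bij_betw_enum[of l] unfolding bij_betw_def by (metis imageE lessThan_iff)
  have "\<exists>!i. i < size_at l \<and> lambda_iota X l (e (Suc l) j) = e l i"
  proof (rule ex1I[of _ i])
    fix i' assume "i' < size_at l \<and> lambda_iota X l (e (Suc l) j) = e l i'"
    then show "i' = i"
      using bij_betw_imp_inj_on[OF bij_betw_enum[of l]] i by (simp add: inj_on_def)
  qed (simp add: i)
  moreover have "i < sms_size (lambda_sms A X e) l \<and> sms_I (lambda_sms A X e) l $$ (i, j) = 1 \<longleftrightarrow>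
      i < size_at l \<and> lambda_iota X l (e (Suc l) j) = e l i" for i
    using j by (cases "lambda_iota X l (e (Suc l) j) = e l i") (simp_all add: lambda_sms_def size_at_def cong: conj_cong)
  ultimately show "\<exists>!i. i < sms_size (lambda_sms A X e) l \<and> sms_I (lambda_sms A X e) l $$ (i, j) = 1"
    by simp
qed

text \<open>\<open>V'\<close> lists the vertices of \<open>Y\<close> with the opposite tag, which
  will be the vertices of the other recoding.\<close>

context
  fixes C D :: "'c set" and n' :: "nat \<Rightarrow> nat"
    and V' :: "nat \<Rightarrow> nat \<Rightarrow> bool \<times> (bool \<times> 'c) list set"
  assumes fin: "finite C" "finite D" and \<phi>: "\<phi> \<in> A \<rightarrow> C \<times> D"
    and V': "\<And>l. lists_tagged Y (2 * l) (\<not> s) (n' l) (V' l)"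
begin

text \<open>Each factor on the right reads one letter over two levels of \<open>Y\<close>, and
  \<open>I M\<close> reads the block over all four. The summation index is the vertex between the
  two letters, which has the opposite tag.\<close>

lemma factor_I_M:
  "map_symbols \<phi> (int_sym_mult (sms_I (lambda_sms A X e) l) (sms_M (lambda_sms A X e) (Suc l))) =
   sym_mult
    (link_mat Y (2 * l) (2 * Suc l) C (\<lambda>c. [(s, c)]) (size_at l) (n' (Suc l)) (vertex_at l) (V' (Suc l)))
    (link_mat Y (2 * Suc l) (2 * Suc (Suc l)) D (\<lambda>d. [(\<not> s, d)])
      (n' (Suc l)) (size_at (Suc (Suc l))) (V' (Suc l)) (vertex_at (Suc (Suc l))))"
proof -
  have im: "\<phi> ` {a \<in> A. link Y (2 * l) (2 * Suc (Suc l)) x (block \<phi> s a) y} =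
    {z \<in> C \<times> D. link Y (2 * l) (2 * Suc (Suc l)) x (case z of (c, d) \<Rightarrow> [(s, c)] @ [(\<not> s, d)]) y}"
    for x y
  proof (intro equalityI subsetI)
    fix z assume "z \<in> \<phi> ` {a \<in> A. link Y (2 * l) (2 * Suc (Suc l)) x (block \<phi> s a) y}"
    then obtain a where "a \<in> A" "z = \<phi> a" "link Y (2 * l) (2 * Suc (Suc l)) x (block \<phi> s a) y" by blast
    moreover have "\<phi> a \<in> C \<times> D" using \<phi> \<open>a \<in> A\<close> by (rule Pi_mem)
    ultimately show "z \<in> {z \<in> C \<times> D. link Y (2 * l) (2 * Suc (Suc l)) x
        (case z of (c, d) \<Rightarrow> [(s, c)] @ [(\<not> s, d)]) y}"
      by (auto simp: block_def)
  next
    fix z assume z: "z \<in> {z \<in> C \<times> D. link Y (2 * l) (2 * Suc (Suc l)) x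
        (case z of (c, d) \<Rightarrow> [(s, c)] @ [(\<not> s, d)]) y}"
    obtain c d where cd: "z = (c, d)" by (cases z)
    let ?u = "[(s, c), (\<not> s, d)]"
    have l: "link Y (2 * l) (2 * Suc (Suc l)) x ?u y" using z cd by simp
    \<comment> \<open>A pair in \<open>C \<times> D\<close> need not be a value of
      \<open>\<phi>\<close>, but one that labels a link is a word of \<open>Y\<close> of length two
      starting with tag \<open>s\<close>, hence a block.\<close>
    then obtain w where "?u @ w \<in> lang Y" unfolding link_def by blast
    then have "?u \<in> lang Y" by (rule lang_prefix) simp
    then obtain v where v: "set v \<subseteq> A" "?u = enc v" using even_word[of ?u] by auto
    have "length v = 1" using arg_cong[OF v(2), of length] by simp
    then obtain a where "v = [a]" by (auto simp: length_Suc_conv)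
    then have "a \<in> A" "\<phi> a = z" "block \<phi> s a = ?u" using v cd by (simp_all add: block_def prod_eq_iff)
    then show "z \<in> \<phi> ` {a \<in> A. link Y (2 * l) (2 * Suc (Suc l)) x (block \<phi> s a) y}"
      using l by force
  qed
  have "map_symbols \<phi> (int_sym_mult (sms_I (lambda_sms A X e) l) (sms_M (lambda_sms A X e) (Suc l))) =
    link_mat Y (2 * l) (2 * Suc (Suc l)) (C \<times> D) (\<lambda>(c, d). [(s, c)] @ [(\<not> s, d)])
      (size_at l) (size_at (Suc (Suc l))) (vertex_at l) (vertex_at (Suc (Suc l)))"
    unfolding int_sym_mult_I_M link_mat_def im[symmetric]
    by (rule map_symbols_set_mat) (rule inj_on_subset[OF inj_\<phi>], blast)
  also have "\<dots> = sym_mult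
    (link_mat Y (2 * l) (2 * Suc l) C (\<lambda>c. [(s, c)]) (size_at l) (n' (Suc l)) (vertex_at l) (V' (Suc l)))
    (link_mat Y (2 * Suc l) (2 * Suc (Suc l)) D (\<lambda>d. [(\<not> s, d)])
      (n' (Suc l)) (size_at (Suc (Suc l))) (V' (Suc l)) (vertex_at (Suc (Suc l))))"
    by (rule sym_mult_link_mat[OF V', symmetric]) (simp_all add: fin)
  finally show ?thesis .
qed

text \<open>Both sides are the matrix of links reading one letter of \<open>C\<close> over four
  levels of \<open>Y\<close>; the empty label may stand after or before that letter.\<close>

lemma intertwine_I:
  "sym_int_mult
    (link_mat Y (2 * l) (2 * Suc l) C (\<lambda>c. [(s, c)]) (size_at l) (n' (Suc l)) (vertex_at l) (V' (Suc l)))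
    (link_ind Y (2 * Suc l) (2 * Suc (Suc l)) (n' (Suc l)) (n' (Suc (Suc l))) (V' (Suc l)) (V' (Suc (Suc l)))) =
   int_sym_mult (sms_I (lambda_sms A X e) l)
    (link_mat Y (2 * Suc l) (2 * Suc (Suc l)) C (\<lambda>c. [(s, c)])
      (size_at (Suc l)) (n' (Suc (Suc l))) (vertex_at (Suc l)) (V' (Suc (Suc l))))"
proof -
  have "sym_int_mult
    (link_mat Y (2 * l) (2 * Suc l) C (\<lambda>c. [(s, c)]) (size_at l) (n' (Suc l)) (vertex_at l) (V' (Suc l)))
    (link_ind Y (2 * Suc l) (2 * Suc (Suc l)) (n' (Suc l)) (n' (Suc (Suc l))) (V' (Suc l)) (V' (Suc (Suc l)))) =
    link_mat Y (2 * l) (2 * Suc (Suc l)) C (\<lambda>c. [(s, c)])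
      (size_at l) (n' (Suc (Suc l))) (vertex_at l) (V' (Suc (Suc l)))"
    by (rule sym_int_mult_link_mat[OF V']) (simp_all add: fin link_target_tag[OF V'])
  also have "\<dots> = int_sym_mult (sms_I (lambda_sms A X e) l)
    (link_mat Y (2 * Suc l) (2 * Suc (Suc l)) C (\<lambda>c. [(s, c)])
      (size_at (Suc l)) (n' (Suc (Suc l))) (vertex_at (Suc l)) (V' (Suc (Suc l))))"
    unfolding sms_I_eq_link_ind
    by (rule int_sym_mult_link_mat[OF lists_tagged_vertex_at, symmetric]) (simp_all add: fin)
  finally show ?thesis .
qed

end

end

end

text \<open>The two codings have opposite tags, so each supplies the intermediate vertices for the
  other, and \<open>factor_I_M\<close> and \<open>intertwine_I\<close> apply twice with the roles
  exchanged.\<close>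

lemma sse_one_step_block_codings:
  fixes \<phi> :: "'a \<Rightarrow> nat \<times> nat" and \<phi>' :: "'b \<Rightarrow> nat \<times> nat"
  assumes bc: "block_coding A X \<phi> s Y" and bc': "block_coding A' X' \<phi>' (\<not> s) Y"
    and ls: "lambda_synchronizing X" and ls': "lambda_synchronizing X'"
    and e: "vertex_enumeration X e" and e': "vertex_enumeration X' e'"
  shows "sse_one_step (lambda_sms A X e) (lambda_sms A' X' e')"
proof -
  interpret P: block_coding A X \<phi> s Y by (rule bc)
  interpret Q: block_coding A' X' \<phi>' "\<not> s" Y by (rule bc')
  define C where "C = fst ` \<phi> ` A \<union> snd ` \<phi>' ` A'"
  define D where "D = snd ` \<phi> ` A \<union> fst ` \<phi>' ` A'"
  have fin: "finite C" "finite D" unfolding C_def D_def by (simp_all add: P.finite_A Q.finite_A)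
  have \<phi>: "\<phi> \<in> A \<rightarrow> C \<times> D" and \<phi>': "\<phi>' \<in> A' \<rightarrow> D \<times> C"
    by (auto simp: C_def D_def mem_Times_iff)
  let ?S = "lambda_sms A X e" and ?S' = "lambda_sms A' X' e'"
  let ?V = "P.vertex_at e" and ?V' = "Q.vertex_at e'"
  define H where "H l = link_mat Y (2 * (l - 1)) (2 * l) C (\<lambda>c. [(s, c)])
    (P.size_at (l - 1)) (Q.size_at l) (?V (l - 1)) (?V' l)" for l
  define K where "K l = link_mat Y (2 * (l - 1)) (2 * l) D (\<lambda>d. [(\<not> s, d)])
    (Q.size_at (l - 1)) (P.size_at l) (?V' (l - 1)) (?V l)" for l
  note V = P.lists_tagged_vertex_at[OF e] and V' = Q.lists_tagged_vertex_at[OF e']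
  \<comment> \<open>Seen from the second coding, whose tag is \<open>\<not> s\<close>, the vertices
    of the first one carry the opposite tag \<open>\<not> \<not> s\<close>.\<close>
  have VV: "lists_tagged Y (2 * l) (\<not> \<not> s) (P.size_at l) (?V l)" for l using V by simp
  have "map_symbols \<phi> (int_sym_mult (sms_I ?S (l - 1)) (sms_M ?S l)) = sym_mult (H l) (K (l + 1)) \<and>
      map_symbols \<phi>' (int_sym_mult (sms_I ?S' (l - 1)) (sms_M ?S' l)) = sym_mult (K l) (H (l + 1)) \<and>
      sym_int_mult (H l) (sms_I ?S' l) = int_sym_mult (sms_I ?S (l - 1)) (H (l + 1)) \<and>
      sym_int_mult (K l) (sms_I ?S l) = int_sym_mult (sms_I ?S' (l - 1)) (K (l + 1))"
    if l: "l \<ge> 1" for l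
  proof -
    obtain k where k: "l = Suc k" using l by (cases l) simp_all
    show ?thesis
      using P.factor_I_M[OF e fin \<phi> V', of k] Q.factor_I_M[OF e' fin(2,1) \<phi>' VV, of k]
        P.intertwine_I[OF e fin \<phi> V', of k] Q.intertwine_I[OF e' fin(2,1) \<phi>' VV, of k]
      unfolding k H_def K_def P.sms_I_eq_link_ind[OF e, of "Suc k"] Q.sms_I_eq_link_ind[OF e', of "Suc k"]
      by (simp only: diff_Suc_1 Suc_eq_plus1[symmetric] not_not simp_thms)
  qed
  moreover have "H l \<in> carrier_mat (sms_size ?S (l - 1)) (sms_size ?S' l) \<and> symbolic_matrix_over C (H l) \<and>
      K l \<in> carrier_mat (sms_size ?S' (l - 1)) (sms_size ?S l) \<and> symbolic_matrix_over D (K l)" for l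
    by (simp add: H_def K_def P.sms_size_lambda_sms[OF e] Q.sms_size_lambda_sms[OF e'] symbolic_matrix_over_link_mat)
  moreover have "\<phi> \<in> sms_alphabet ?S \<rightarrow> C \<times> D" "inj_on \<phi> (sms_alphabet ?S)"
    "\<phi>' \<in> sms_alphabet ?S' \<rightarrow> D \<times> C" "inj_on \<phi>' (sms_alphabet ?S')"
    using \<phi> \<phi>' P.inj_\<phi> Q.inj_\<phi> by (simp_all add: lambda_sms_def)
  ultimately show ?thesis
    unfolding sse_one_step_def
    using P.symbolic_matrix_system_lambda_sms[OF e ls] Q.symbolic_matrix_system_lambda_sms[OF e' ls'] fin
    by blast
qed

section \<open>Bipartite codes\<close>

lemma encode_nth:
  assumes "k < length w"
  shows "encode \<phi> s w ! (2 * k) = (s, fst (\<phi> (w ! k)))"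
    and "encode \<phi> s w ! Suc (2 * k) = (\<not> s, snd (\<phi> (w ! k)))"
proof -
  have "encode \<phi> s w ! (2 * k) = (s, fst (\<phi> (w ! k))) \<and>
      encode \<phi> s w ! Suc (2 * k) = (\<not> s, snd (\<phi> (w ! k)))"
    using assms
  proof (induction w arbitrary: k)
    case (Cons a w)
    then show ?case by (cases k) simp_all
  qed simp
  then show "encode \<phi> s w ! (2 * k) = (s, fst (\<phi> (w ! k)))"
    and "encode \<phi> s w ! Suc (2 * k) = (\<not> s, snd (\<phi> (w ! k)))" by simp_all
qed

lemma nth_even_odd_eqI:
  assumes "length u = 2 * n" "length w = 2 * n"
    and "\<And>k. k < n \<Longrightarrow> u ! (2 * k) = w ! (2 * k)" "\<And>k. k < n \<Longrightarrow> u ! Suc (2 * k) = w ! Suc (2 * k)"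
  shows "u = w"
proof (rule nth_equalityI)
  fix i assume "i < length u"
  then show "u ! i = w ! i"
    using assms by (cases "even i") (auto elim!: evenE oddE)
qed (simp add: assms)

lemma lang_image_iff:
  "w \<in> lang (p ` Z) \<longleftrightarrow> w \<noteq> [] \<and> (\<exists>z\<in>Z. \<exists>i. \<forall>k<length w. w ! k = p z (i + int k))"
  by (auto simp: lang_def)

text \<open>\<open>I z\<close> interleaves the two letters of each block; the offset
  \<open>r\<close> is the position at which the block of coordinate 0 starts.\<close>

lemma block_coding_interleaved:
  fixes I :: "'z \<Rightarrow> int \<Rightarrow> bool \<times> 'c" and p :: "'z \<Rightarrow> int \<Rightarrow> 'a"
  assumes "finite A" "inj_on \<phi> A" and p: "\<And>z i. z \<in> Z \<Longrightarrow> p z i \<in> A"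
    and I0: "\<And>z i. z \<in> Z \<Longrightarrow> I z (2 * i + r) = (s, fst (\<phi> (p z i)))"
    and I1: "\<And>z i. z \<in> Z \<Longrightarrow> I z (2 * i + r + 1) = (\<not> s, snd (\<phi> (p z i)))"
  shows "block_coding A (p ` Z) \<phi> s (I ` Z)"
proof
  show "finite A" "inj_on \<phi> A" by (rule assms)+
  show "x i \<in> A" if "x \<in> p ` Z" for x i using that p by blast
  \<comment> \<open>The tag of a letter reveals the parity of its position, so a word with first tag
    \<open>s\<close> starts at a block boundary.\<close>
  have tag: "fst (I z j) = s \<longleftrightarrow> even (j - r)" if "z \<in> Z" for z j
  proof (cases "even (j - r)")
    case True
    then obtain i where "j = 2 * i + r" by (metis add.commute diff_add_cancel evenE)
    then show ?thesis using I0[OF that, of i] by simp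
  next
    case False
    then obtain i where "j - r = 2 * i + 1" by (rule oddE)
    then have "j = 2 * i + r + 1" by simp
    then show ?thesis using I1[OF that, of i] False by simp
  qed
  show "fst (w ! k) = (fst (hd w) = even k)" if w: "w \<in> lang (I ` Z)" "k < length w" for w k
  proof -
    obtain z i where z: "z \<in> Z" "\<forall>k<length w. w ! k = I z (i + int k)"
      using w(1) unfolding lang_image_iff by blast
    have "hd w = w ! 0" using w(2) by (cases w) simp_all
    moreover have "0 < length w" using w(2) by linarith
    ultimately have "hd w = I z i" "w ! k = I z (i + int k)"
      using z(2)[rule_format, of 0] z(2)[rule_format, of k] w(2) by simp_all
    then show ?thesis using tag[OF z(1), of i] tag[OF z(1), of "i + int k"] by auto
  qed
  have encoded: "encode \<phi> s v = w"
    if z: "z \<in> Z" "\<forall>k<length w. w ! k = I z (2 * m + r + int k)"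
      and v: "length w = 2 * length v" "\<And>k. k < length v \<Longrightarrow> v ! k = p z (m + int k)" for z m v w
  proof (rule nth_even_odd_eqI[of _ "length v"])
    fix k assume k: "k < length v"
    have "w ! (2 * k) = I z (2 * (m + int k) + r)"
      using z(2) v(1) k by (simp add: algebra_simps)
    then show "encode \<phi> s v ! (2 * k) = w ! (2 * k)"
      using encode_nth(1)[OF k] v(2)[OF k] I0[OF z(1), of "m + int k"] by simp
    have "w ! Suc (2 * k) = I z (2 * (m + int k) + r + 1)"
      using z(2) v(1) k by (simp add: algebra_simps)
    then show "encode \<phi> s v ! Suc (2 * k) = w ! Suc (2 * k)"
      using encode_nth(2)[OF k] v(2)[OF k] I1[OF z(1), of "m + int k"] by simp
  qed (simp_all add: v(1))
  have aligned: "\<exists>z\<in>Z. \<exists>m. \<forall>k<length w. w ! k = I z (2 * m + r + int k)"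
    if w: "w \<in> lang (I ` Z)" "fst (hd w) = s" for w
  proof -
    obtain z i where z: "w \<noteq> []" "z \<in> Z" "\<forall>k<length w. w ! k = I z (i + int k)"
      using w(1) unfolding lang_image_iff by blast
    then have "hd w = I z i" by (simp add: hd_conv_nth)
    then have "even (i - r)" using tag[OF z(2)] w(2) by simp
    then obtain m where "i = 2 * m + r" by (metis add.commute diff_add_cancel evenE)
    then show ?thesis using z by blast
  qed
  show "\<exists>v. set v \<subseteq> A \<and> w = encode \<phi> s v"
    if w: "w \<in> lang (I ` Z)" "fst (hd w) = s" "even (length w)" for w
  proof -
    obtain z m where z: "z \<in> Z" "\<forall>k<length w. w ! k = I z (2 * m + r + int k)"
      using aligned[OF w(1,2)] by blast
    define v where "v = map (\<lambda>k. p z (m + int k)) [0..<length w div 2]"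
    have "encode \<phi> s v = w"
      by (rule encoded[OF z]) (use w(3) in \<open>simp_all add: v_def\<close>)
    moreover have "set v \<subseteq> A" using p[OF z(1)] by (auto simp: v_def)
    ultimately show ?thesis by blast
  qed
  show "encode \<phi> s w \<in> lang (I ` Z) \<longleftrightarrow> w \<in> lang (p ` Z)" if w: "set w \<subseteq> A" "w \<noteq> []" for w
  proof
    assume h: "encode \<phi> s w \<in> lang (I ` Z)"
    have "fst (hd (encode \<phi> s w)) = s" using w(2) by (simp add: hd_encode)
    then obtain z m where z: "z \<in> Z"
        "\<forall>k<length (encode \<phi> s w). encode \<phi> s w ! k = I z (2 * m + r + int k)"
      using aligned[OF h] by blast
    define v where "v = map (\<lambda>k. p z (m + int k)) [0..<length w]"
    have "encode \<phi> s v = encode \<phi> s w"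
      by (rule encoded[OF z]) (simp_all add: v_def)
    moreover have "set v \<subseteq> A" using p[OF z(1)] by (auto simp: v_def)
    ultimately have "v = w" using encode_inj[OF assms(2) _ w(1)] by blast
    moreover have "v ! k = p z (m + int k)" if "k < length w" for k
      using that by (simp add: v_def)
    ultimately have "w ! k = p z (m + int k)" if "k < length w" for k
      using that by simp
    then show "w \<in> lang (p ` Z)" unfolding lang_image_iff using w(2) z(1) by blast
  next
    assume "w \<in> lang (p ` Z)"
    then obtain z m where z: "z \<in> Z" "\<forall>k<length w. w ! k = p z (m + int k)"
      unfolding lang_image_iff by blast
    define u where "u = map (\<lambda>k. I z (2 * m + r + int k)) [0..<2 * length w]"
    have "encode \<phi> s w = u"
      by (rule encoded[OF z(1)]) (use z(2) in \<open>simp_all add: u_def\<close>)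
    moreover have "u \<in> lang (I ` Z)" unfolding lang_image_iff
      using w(2) z(1) by (auto simp: u_def intro!: bexI[of _ z] exI[of _ "2 * m + r"])
    ultimately show "encode \<phi> s w \<in> lang (I ` Z)" by simp
  qed
qed

text \<open>Letters \<open>c\<close> stand at the even and letters \<open>d\<close> at the odd
  places of one bi-infinite sequence. Cutting before the even places (offset 0) gives
  \<open>p\<close>, cutting before the odd places (offset 1) gives \<open>p'\<close>.\<close>

lemma block_codings_bipartite:
  fixes c d :: "'z \<Rightarrow> int \<Rightarrow> 'c"
  assumes "finite A" "finite A'" "inj_on \<phi> A" "inj_on \<phi>' A'"
    and "\<And>z i. z \<in> Z \<Longrightarrow> p z i \<in> A" "\<And>z i. z \<in> Z \<Longrightarrow> p' z i \<in> A'"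
    and "\<And>z i. z \<in> Z \<Longrightarrow> \<phi> (p z i) = (c z i, d z i)"
    and "\<And>z i. z \<in> Z \<Longrightarrow> \<phi>' (p' z i) = (d z i, c z (i + 1))"
  shows "\<exists>Y. block_coding A (p ` Z) \<phi> True Y \<and> block_coding A' (p' ` Z) \<phi>' False Y"
proof -
  define I where "I z j = (if even j then (True, c z (j div 2)) else (False, d z (j div 2)))" for z and j :: int
  have "(2 * i + 1 + 1) div 2 = i + 1" for i :: int by simp
  then have "block_coding A' (p' ` Z) \<phi>' False (I ` Z)"
    using assms by (intro block_coding_interleaved[where r = 1]) (simp_all add: I_def add.commute)
  moreover have "block_coding A (p ` Z) \<phi> True (I ` Z)"
    using assms by (intro block_coding_interleaved[where r = 0]) (simp_all add: I_def)
  ultimately show ?thesis by blast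
qed

lemma sse_one_step_sym:
  assumes "sse_one_step S S'" shows "sse_one_step S' S"
proof -
  obtain C D :: "nat set" and \<phi> \<phi>' H K where *:
    "symbolic_matrix_system S" "symbolic_matrix_system S'" "finite C" "finite D"
    "\<phi> \<in> sms_alphabet S \<rightarrow> C \<times> D" "inj_on \<phi> (sms_alphabet S)"
    "\<phi>' \<in> sms_alphabet S' \<rightarrow> D \<times> C" "inj_on \<phi>' (sms_alphabet S')"
    and H: "\<forall>l\<ge>1. H l \<in> carrier_mat (sms_size S (l - 1)) (sms_size S' l) \<and> symbolic_matrix_over C (H l) \<and>
           K l \<in> carrier_mat (sms_size S' (l - 1)) (sms_size S l) \<and> symbolic_matrix_over D (K l)"
    and eqs: "\<forall>l\<ge>1.
           map_symbols \<phi> (int_sym_mult (sms_I S (l - 1)) (sms_M S l)) = sym_mult (H l) (K (l + 1)) \<and>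
           map_symbols \<phi>' (int_sym_mult (sms_I S' (l - 1)) (sms_M S' l)) = sym_mult (K l) (H (l + 1)) \<and>
           sym_int_mult (H l) (sms_I S' l) = int_sym_mult (sms_I S (l - 1)) (H (l + 1)) \<and>
           sym_int_mult (K l) (sms_I S l) = int_sym_mult (sms_I S' (l - 1)) (K (l + 1))"
    using assms unfolding sse_one_step_def by blast
  have H': "\<forall>l\<ge>1. K l \<in> carrier_mat (sms_size S' (l - 1)) (sms_size S l) \<and> symbolic_matrix_over D (K l) \<and>
      H l \<in> carrier_mat (sms_size S (l - 1)) (sms_size S' l) \<and> symbolic_matrix_over C (H l)"
    using H by (simp only: conj_ac)
  have eqs': "\<forall>l\<ge>1.
      map_symbols \<phi>' (int_sym_mult (sms_I S' (l - 1)) (sms_M S' l)) = sym_mult (K l) (H (l + 1)) \<and>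
      map_symbols \<phi> (int_sym_mult (sms_I S (l - 1)) (sms_M S l)) = sym_mult (H l) (K (l + 1)) \<and>
      sym_int_mult (K l) (sms_I S l) = int_sym_mult (sms_I S' (l - 1)) (K (l + 1)) \<and>
      sym_int_mult (H l) (sms_I S' l) = int_sym_mult (sms_I S (l - 1)) (H (l + 1))"
    using eqs by (simp only: conj_ac)
  show ?thesis
    unfolding sse_one_step_def
    by (intro conjI exI[of _ D] exI[of _ C] exI[of _ \<phi>'] exI[of _ \<phi>] exI[of _ K] exI[of _ H] * H' eqs')
qed

section \<open>Decomposition of a conjugacy\<close>

definition symbols_of :: "'z set \<Rightarrow> ('z \<Rightarrow> int \<Rightarrow> 'a) \<Rightarrow> 'a set" where
  "symbols_of Z p = {p z i | z i. z \<in> Z}"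

lemma symbols_of_all: "\<forall>z\<in>Z. \<forall>i. p z i \<in> symbols_of Z p"
  by (auto simp: symbols_of_def)

lemma symbols_ofI: "z \<in> Z \<Longrightarrow> p z i \<in> symbols_of Z p"
  by (auto simp: symbols_of_def)

text \<open>Expresses that \<open>p\<close> and \<open>q\<close> differ by a renaming of symbols,
  the same at all places of all points, without exhibiting the renaming;
  \<open>same_partition_code\<close> recovers it.\<close>

definition same_partition :: "'z set \<Rightarrow> ('z \<Rightarrow> int \<Rightarrow> 'a) \<Rightarrow> ('z \<Rightarrow> int \<Rightarrow> 'b) \<Rightarrow> bool" where
  "same_partition Z p q \<longleftrightarrow> (\<forall>z\<in>Z. \<forall>z'\<in>Z. \<forall>i i'. p z i = p z' i' \<longleftrightarrow> q z i = q z' i')"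

lemma same_partition_code:
  assumes "same_partition Z p q"
  obtains \<phi> where "inj_on \<phi> (symbols_of Z p)" "\<forall>z\<in>Z. \<forall>i. \<phi> (p z i) = q z i"
proof -
  define \<phi> where "\<phi> a = (SOME b. \<exists>z\<in>Z. \<exists>i. p z i = a \<and> q z i = b)" for a
  have \<phi>: "\<phi> (p z i) = q z i" if "z \<in> Z" for z i
  proof -
    have "\<exists>z'\<in>Z. \<exists>i'. p z' i' = p z i \<and> q z' i' = \<phi> (p z i)"
      unfolding \<phi>_def by (rule someI[of _ "q z i"]) (use that in blast)
    then show ?thesis using assms that unfolding same_partition_def by metis
  qed
  moreover have "inj_on \<phi> (symbols_of Z p)"
    using \<phi> assms unfolding inj_on_def symbols_of_def same_partition_def by auto
  ultimately show ?thesis using that by blast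
qed

lemma ex_vertex_enumeration:
  assumes "finite A" "\<forall>x\<in>X. \<forall>i. x i \<in> A"
  shows "\<exists>e. vertex_enumeration X e"
proof -
  have "\<exists>f. bij_betw f {..<card (lambda_vertices X l)} (lambda_vertices X l)" for l
  proof -
    have "finite (lambda_vertices X l)" by (rule finite_lambda_vertices[of A]) (use assms in blast)+
    then show ?thesis using ex_bij_betw_nat_finite by (metis atLeast0LessThan)
  qed
  then show ?thesis unfolding vertex_enumeration_def by (rule choice[OF allI])
qed

lemma sse_one_step_bipartite:
  fixes c d :: "'z \<Rightarrow> int \<Rightarrow> nat"
  assumes "finite A" "finite A'" "inj_on \<phi> A" "inj_on \<phi>' A'"
    and "\<forall>z\<in>Z. \<forall>i. p z i \<in> A" "\<forall>z\<in>Z. \<forall>i. p' z i \<in> A'"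
    and "\<forall>z\<in>Z. \<forall>i. \<phi> (p z i) = (c z i, d z i)"
    and "\<forall>z\<in>Z. \<forall>i. \<phi>' (p' z i) = (d z i, c z (i + 1))"
  shows "lambda_synchronizing (p ` Z) \<longleftrightarrow> lambda_synchronizing (p' ` Z)"
    and "lambda_synchronizing (p ` Z) \<Longrightarrow> vertex_enumeration (p ` Z) e \<Longrightarrow>
      vertex_enumeration (p' ` Z) e' \<Longrightarrow>
      sse_one_step (lambda_sms A (p ` Z) e) (lambda_sms A' (p' ` Z) e')"
proof -
  obtain Y where Y: "block_coding A (p ` Z) \<phi> True Y" "block_coding A' (p' ` Z) \<phi>' False Y"
    using block_codings_bipartite[of A A' \<phi> \<phi>' Z p p' c d] assms by blast
  show ls: "lambda_synchronizing (p ` Z) \<longleftrightarrow> lambda_synchronizing (p' ` Z)"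
    using block_coding.lambda_synchronizing_iff[OF Y(1)]
      block_coding.lambda_synchronizing_iff[OF Y(2)] by simp
  show "sse_one_step (lambda_sms A (p ` Z) e) (lambda_sms A' (p' ` Z) e')"
    if "lambda_synchronizing (p ` Z)" "vertex_enumeration (p ` Z) e" "vertex_enumeration (p' ` Z) e'"
    using sse_one_step_block_codings[OF Y(1)] Y(2) that ls by simp
qed

text \<open>A subshift is presented by the sequences \<open>p z\<close> for \<open>z\<close> in a fixed index set \<open>Z\<close>, so that
  sliding block codes between subshifts become relations between presentations.\<close>

definition sms_of :: "'z set \<Rightarrow> ('z \<Rightarrow> int \<Rightarrow> 'a) \<Rightarrow> 'a sms" where
  "sms_of Z p = lambda_sms (symbols_of Z p) (p ` Z) (SOME e. vertex_enumeration (p ` Z) e)"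

text \<open>Bipartite codes in the sense of Nasu, up to renaming of symbols. The letters are natural
  numbers because \<open>sse_one_step\<close> takes its auxiliary alphabets there.\<close>

definition bipartite_step :: "'z set \<Rightarrow> ('z \<Rightarrow> int \<Rightarrow> 'a) \<Rightarrow> ('z \<Rightarrow> int \<Rightarrow> 'b) \<Rightarrow> bool" where
  "bipartite_step Z p p' \<longleftrightarrow> (\<exists>(c :: 'z \<Rightarrow> int \<Rightarrow> nat) (d :: 'z \<Rightarrow> int \<Rightarrow> nat).
     same_partition Z p (\<lambda>z i. (c z i, d z i)) \<and> same_partition Z p' (\<lambda>z i. (d z i, c z (i + 1))))"

definition step_related where
  "step_related Z p p' \<longleftrightarrow> bipartite_step Z p p' \<or> bipartite_step Z p' p"

definition finite_synchronizing where
  "finite_synchronizing Z p \<longleftrightarrow> finite (symbols_of Z p) \<and> lambda_synchronizing (p ` Z)"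

lemma vertex_enumeration_some:
  assumes "finite (symbols_of Z p)"
  shows "vertex_enumeration (p ` Z) (SOME e. vertex_enumeration (p ` Z) e)"
  using ex_vertex_enumeration[of "symbols_of Z p" "p ` Z"] assms symbols_ofI[of _ Z p]
  by (intro someI_ex[of "vertex_enumeration (p ` Z)"]) blast

text \<open>A symbol of \<open>p'\<close> is determined by two neighbouring symbols of
  \<open>p\<close>, and vice versa.\<close>

lemma bipartite_step_finite:
  assumes "bipartite_step Z p p'"
  shows "finite (symbols_of Z p) \<longleftrightarrow> finite (symbols_of Z p')"
proof -
  obtain c d :: "'a \<Rightarrow> int \<Rightarrow> nat" where
    pc: "same_partition Z p (\<lambda>z i. (c z i, d z i))"
    and pc': "same_partition Z p' (\<lambda>z i. (d z i, c z (i + 1)))"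
    using assms unfolding bipartite_step_def by blast
  obtain \<phi> where \<phi>: "inj_on \<phi> (symbols_of Z p)" "\<forall>z\<in>Z. \<forall>i. \<phi> (p z i) = (c z i, d z i)"
    using same_partition_code[OF pc] by blast
  obtain \<phi>' where \<phi>': "inj_on \<phi>' (symbols_of Z p')"
    "\<forall>z\<in>Z. \<forall>i. \<phi>' (p' z i) = (d z i, c z (i + 1))"
    using same_partition_code[OF pc'] by blast
  show ?thesis
  proof
    assume f: "finite (symbols_of Z p)"
    have "\<phi>' ` symbols_of Z p' \<subseteq> snd ` \<phi> ` symbols_of Z p \<times> fst ` \<phi> ` symbols_of Z p"
    proof
      fix x assume "x \<in> \<phi>' ` symbols_of Z p'"
      then obtain z i where z: "z \<in> Z" "x = (d z i, c z (i + 1))"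
        using \<phi>'(2) by (auto simp: symbols_of_def)
      have "d z i = snd (\<phi> (p z i))" "c z (i + 1) = fst (\<phi> (p z (i + 1)))"
        using \<phi>(2) z(1) by simp_all
      then show "x \<in> snd ` \<phi> ` symbols_of Z p \<times> fst ` \<phi> ` symbols_of Z p"
        unfolding z(2) using symbols_ofI[OF z(1)] by blast
    qed
    then have "finite (\<phi>' ` symbols_of Z p')" by (rule finite_subset) (use f in simp)
    then show "finite (symbols_of Z p')" using \<phi>'(1) by (rule finite_imageD)
  next
    assume f: "finite (symbols_of Z p')"
    have "\<phi> ` symbols_of Z p \<subseteq> snd ` \<phi>' ` symbols_of Z p' \<times> fst ` \<phi>' ` symbols_of Z p'"
    proof
      fix x assume "x \<in> \<phi> ` symbols_of Z p"
      then obtain z i where z: "z \<in> Z" "x = (c z i, d z i)"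
        using \<phi>(2) by (auto simp: symbols_of_def)
      have "d z i = fst (\<phi>' (p' z i))" "c z i = snd (\<phi>' (p' z (i - 1)))"
        using \<phi>'(2) z(1) by simp_all
      then show "x \<in> snd ` \<phi>' ` symbols_of Z p' \<times> fst ` \<phi>' ` symbols_of Z p'"
        unfolding z(2) using symbols_ofI[OF z(1)] by blast
    qed
    then have "finite (\<phi> ` symbols_of Z p)" by (rule finite_subset) (use f in simp)
    then show "finite (symbols_of Z p)" using \<phi>(1) by (rule finite_imageD)
  qed
qed

lemma bipartite_step_sse:
  assumes "bipartite_step Z p p'" "finite (symbols_of Z p)"
  shows "finite_synchronizing Z p \<longleftrightarrow> finite_synchronizing Z p'"
    and "finite_synchronizing Z p \<Longrightarrow> sse_one_step (sms_of Z p) (sms_of Z p')"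
proof -
  have f': "finite (symbols_of Z p')" using bipartite_step_finite[OF assms(1)] assms(2) by simp
  obtain c d :: "'a \<Rightarrow> int \<Rightarrow> nat" where
    pc: "same_partition Z p (\<lambda>z i. (c z i, d z i))"
    and pc': "same_partition Z p' (\<lambda>z i. (d z i, c z (i + 1)))"
    using assms(1) unfolding bipartite_step_def by blast
  obtain \<phi> where \<phi>: "inj_on \<phi> (symbols_of Z p)" "\<forall>z\<in>Z. \<forall>i. \<phi> (p z i) = (c z i, d z i)"
    using same_partition_code[OF pc] by blast
  obtain \<phi>' where \<phi>': "inj_on \<phi>' (symbols_of Z p')"
    "\<forall>z\<in>Z. \<forall>i. \<phi>' (p' z i) = (d z i, c z (i + 1))"
    using same_partition_code[OF pc'] by blast
  note step = sse_one_step_bipartite[OF assms(2) f' \<phi>(1) \<phi>'(1) symbols_of_all symbols_of_all \<phi>(2) \<phi>'(2)]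
  show "finite_synchronizing Z p \<longleftrightarrow> finite_synchronizing Z p'"
    using step(1) assms(2) f' by (simp add: finite_synchronizing_def)
  show "sse_one_step (sms_of Z p) (sms_of Z p')" if "finite_synchronizing Z p"
    using step(2) that vertex_enumeration_some[OF assms(2)] vertex_enumeration_some[OF f']
    by (simp add: finite_synchronizing_def sms_of_def)
qed

lemma step_related_sse:
  assumes "step_related Z p p'" "finite_synchronizing Z p"
  shows "finite_synchronizing Z p' \<and> sse_one_step (sms_of Z p) (sms_of Z p')"
  using assms(1) unfolding step_related_def
proof
  assume h: "bipartite_step Z p p'"
  then show ?thesis using bipartite_step_sse[OF h] assms(2) by (simp add: finite_synchronizing_def)
next
  assume h: "bipartite_step Z p' p"
  then have "finite (symbols_of Z p')"
    using bipartite_step_finite[OF h] assms(2) by (simp add: finite_synchronizing_def)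
  then show ?thesis using bipartite_step_sse[OF h] assms(2) sse_one_step_sym by blast
qed

lemma step_related_chain_sse:
  assumes "(step_related Z)\<^sup>*\<^sup>* p p'" "finite_synchronizing Z p"
  shows "finite_synchronizing Z p' \<and> sse_one_step\<^sup>*\<^sup>* (sms_of Z p) (sms_of Z p')"
  using assms(1)
proof (induction rule: rtranclp_induct)
  case base
  then show ?case using assms(2) by simp
next
  case (step q r)
  then have "finite_synchronizing Z r \<and> sse_one_step (sms_of Z q) (sms_of Z r)" using step_related_sse by blast
  then show ?case using step.IH by (meson rtranclp.rtrancl_into_rtrancl)
qed

lemma step_related_chain_sym: "(step_related Z)\<^sup>*\<^sup>* p p' \<Longrightarrow> (step_related Z)\<^sup>*\<^sup>* p' p"
  by (rule sympD[OF symp_rtranclp]) (auto intro!: sympI simp: step_related_def)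

section \<open>Chains of windows\<close>

lemma same_partition_step:
  fixes p q :: "'z \<Rightarrow> int \<Rightarrow> nat"
  assumes "same_partition Z p q" shows "step_related Z p q"
proof -
  \<comment> \<open>With the constant 0 as \<open>c\<close> and \<open>p\<close> as
    \<open>d\<close>, passing from cd to dc only swaps the components.\<close>
  have "same_partition Z p (\<lambda>z i. (0 :: nat, p z i))" "same_partition Z q (\<lambda>z i. (p z i, 0 :: nat))"
    using assms by (simp_all add: same_partition_def)
  then show ?thesis unfolding step_related_def bipartite_step_def by fast
qed

text \<open>Coding by \<open>to_nat\<close> keeps the symbols natural numbers, so that all sequences
  of a chain have the same type.\<close>

definition window :: "('z \<Rightarrow> int \<Rightarrow> nat) \<Rightarrow> ('z \<Rightarrow> int \<Rightarrow> nat) \<Rightarrow> nat \<Rightarrow> nat \<Rightarrow> 'z \<Rightarrow> int \<Rightarrow> nat" where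
  "window p q a b z i = to_nat (p z i, map (\<lambda>k. q z (i + k)) [- int a..int b])"

lemma window_eq_iff:
  "window p q a b z i = window p q a b z' i' \<longleftrightarrow>
    p z i = p z' i' \<and> (\<forall>k\<in>{- int a..int b}. q z (i + k) = q z' (i' + k))"
  by (simp add: window_def)

lemma window_symmetric_eq_iff:
  "window p q n n z i = window p q n n z' i' \<longleftrightarrow>
    p z i = p z' i' \<and> (\<forall>k. \<bar>k\<bar> \<le> int n \<longrightarrow> q z (i + k) = q z' (i' + k))"
  unfolding window_eq_iff by (metis abs_le_iff atLeastAtMost_iff minus_le_iff)

definition determined_by where
  "determined_by Z q p \<longleftrightarrow> (\<forall>z\<in>Z. \<forall>z'\<in>Z. \<forall>i i'. p z i = p z' i' \<longrightarrow> q z i = q z' i')"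

lemma window_step_right:
  "step_related Z (window p q a b) (window p q a (Suc b))"
proof -
  have "{- int a..int (Suc b)} = insert (1 + int b) {- int a..int b}" by auto
  then have "same_partition Z (window p q a (Suc b)) (\<lambda>z i. (window p q a b z i, q z (i + 1 + int b)))"
    by (auto simp: same_partition_def window_eq_iff add.assoc)
  \<comment> \<open>The letter \<open>c\<close> is the last symbol of \<open>q\<close> in the
    window, so pairing it with the window adds no information; moved on by one place it is the
    symbol to be appended.\<close>
  moreover have "same_partition Z (window p q a b) (\<lambda>z i. (q z (i + int b), window p q a b z i))"
    by (auto simp: same_partition_def window_eq_iff)
  ultimately show ?thesis unfolding step_related_def bipartite_step_def by fast
qed

lemma window_step_left:
  "step_related Z (window p q a b) (window p q (Suc a) b)"
proof -
  have "{- int (Suc a)..int b} = insert (- 1 - int a) {- int a..int b}" by auto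
  \<comment> \<open>Here the step starts from the larger window: \<open>c\<close> is its leftmost
    symbol of \<open>q\<close>, and moved on by one place it already lies in the smaller
    window.\<close>
  then have "same_partition Z (window p q (Suc a) b) (\<lambda>z i. (q z (i - 1 - int a), window p q a b z i))"
    by (auto simp: same_partition_def window_eq_iff algebra_simps)
  moreover have q: "q z (i - int a) = q z' (i' - int a)" if "window p q a b z i = window p q a b z' i'" for z i z' i'
    using that unfolding window_eq_iff by (auto dest: bspec[of _ _ "- int a"])
  then have "same_partition Z (window p q a b) (\<lambda>z i. (window p q a b z i, q z (i + 1 - 1 - int a)))"
    unfolding same_partition_def
  proof (intro ballI allI)
    fix z z' i i'
    show "window p q a b z i = window p q a b z' i' \<longleftrightarrow>
      (window p q a b z i, q z (i + 1 - 1 - int a)) = (window p q a b z' i', q z' (i' + 1 - 1 - int a))"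
      using q[of z i z' i'] by auto
  qed
  ultimately show ?thesis unfolding step_related_def bipartite_step_def by fast
qed

lemma window_chain:
  assumes "determined_by Z q p"
  shows "(step_related Z)\<^sup>*\<^sup>* p (window p q n n)"
proof (induction n)
  case 0
  \<comment> \<open>The window of radius 0 adjoins the symbol of \<open>q\<close> at the same place,
    which \<open>p\<close> determines.\<close>
  have "same_partition Z p (window p q 0 0)"
    unfolding same_partition_def
  proof (intro ballI allI)
    fix z z' i i' assume z: "z \<in> Z" "z' \<in> Z"
    then have "p z i = p z' i' \<Longrightarrow> q z i = q z' i'"
      using assms unfolding determined_by_def by blast
    then show "p z i = p z' i' \<longleftrightarrow> window p q 0 0 z i = window p q 0 0 z' i'"
      by (auto simp: window_symmetric_eq_iff)
  qed
  then show ?case using same_partition_step by blast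
next
  case (Suc n)
  then show ?case
    using window_step_right[of Z p q n n] window_step_left[of Z p q n "Suc n"]
    by (meson rtranclp.rtrancl_into_rtrancl)
qed

lemma conjugate_chain:
  fixes p q :: "'z \<Rightarrow> int \<Rightarrow> nat"
  assumes pq: "\<And>z z' i i'. z \<in> Z \<Longrightarrow> z' \<in> Z \<Longrightarrow>
      (\<And>k. \<bar>k\<bar> \<le> int n \<Longrightarrow> p z (i + k) = p z' (i' + k)) \<Longrightarrow> q z i = q z' i'"
    and qp: "\<And>z z' i i'. z \<in> Z \<Longrightarrow> z' \<in> Z \<Longrightarrow>
      (\<And>k. \<bar>k\<bar> \<le> int m \<Longrightarrow> q z (i + k) = q z' (i' + k)) \<Longrightarrow> p z i = p z' i'"
  shows "(step_related Z)\<^sup>*\<^sup>* p q"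
proof -
  \<comment> \<open>\<open>P\<close> sees enough of \<open>p\<close> to determine \<open>q\<close>.
    A place within n of i has its whole neighbourhood of radius m within m + n of i, so
    \<open>T\<close> determines every symbol of \<open>p\<close> inside \<open>P\<close>; hence
    \<open>R\<close> and \<open>T\<close> carry the same information.\<close>
  define P where "P = window p p n n"
  define R where "R = window P q (m + n) (m + n)"
  define T where "T = window q q (m + n) (m + n)"
  have self: "determined_by Z r r" for r :: "'z \<Rightarrow> int \<Rightarrow> nat" by (simp add: determined_by_def)
  have 1: "(step_related Z)\<^sup>*\<^sup>* p P" unfolding P_def by (rule window_chain[OF self])
  have "determined_by Z q P"
    unfolding determined_by_def
  proof (intro ballI allI impI)
    fix z z' i i' assume z: "z \<in> Z" "z' \<in> Z" and h: "P z i = P z' i'"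
    show "q z i = q z' i'"
      by (rule pq[OF z]) (use h in \<open>simp add: P_def window_symmetric_eq_iff\<close>)
  qed
  then have 2: "(step_related Z)\<^sup>*\<^sup>* P R" unfolding R_def by (rule window_chain)
  have "same_partition Z R T"
    unfolding same_partition_def
  proof (intro ballI allI iffI)
    fix z z' i i' assume z: "z \<in> Z" "z' \<in> Z"
    show "T z i = T z' i'" if "R z i = R z' i'"
      using that unfolding R_def T_def window_symmetric_eq_iff
      by (metis abs_zero add.right_neutral of_nat_0_le_iff)
    assume T: "T z i = T z' i'"
    have h: "q z (i + k) = q z' (i' + k)" if "\<bar>k\<bar> \<le> int (m + n)" for k
      using that T by (simp add: T_def window_symmetric_eq_iff)
    have "p z (i + k) = p z' (i' + k)" if "\<bar>k\<bar> \<le> int n" for k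
    proof (rule qp[OF z])
      fix l assume "\<bar>l\<bar> \<le> int m"
      then show "q z (i + k + l) = q z' (i' + k + l)"
        using h[of "k + l"] that by (simp add: add.assoc)
    qed
    from this[of 0] this have "P z i = P z' i'" by (simp add: P_def window_symmetric_eq_iff)
    then show "R z i = R z' i'" using h by (simp add: R_def window_symmetric_eq_iff)
  qed
  then have 3: "(step_related Z)\<^sup>*\<^sup>* R T" using same_partition_step by blast
  have "(step_related Z)\<^sup>*\<^sup>* T q"
    unfolding T_def by (rule step_related_chain_sym[OF window_chain[OF self]])
  with 1 2 3 show ?thesis by (meson rtranclp_trans)
qed

section \<open>Sliding block windows\<close>

lemma topspace_full_shift: "topspace (full_shift A) = {x. \<forall>i. x i \<in> A}"
  by (auto simp: full_shift_def)

lemma openin_cylinder: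
  assumes "\<And>i. x i \<in> A"
  shows "openin (full_shift A) {y. (\<forall>i. y i \<in> A) \<and> (\<forall>i. \<bar>i\<bar> \<le> int n \<longrightarrow> y i = x i)}"
proof -
  let ?U = "\<lambda>i. if \<bar>i\<bar> \<le> int n then {x i} else A"
  have "finite {i. ?U i \<noteq> A}"
    by (rule finite_subset[of _ "{- int n..int n}"]) auto
  then have "openin (full_shift A) (Pi\<^sub>E UNIV ?U)"
    unfolding full_shift_def using assms by (simp add: openin_PiE_gen)
  moreover have "Pi\<^sub>E UNIV ?U = {y. (\<forall>i. y i \<in> A) \<and> (\<forall>i. \<bar>i\<bar> \<le> int n \<longrightarrow> y i = x i)}"
    using assms by (auto simp: PiE_iff split: if_splits)
  ultimately show ?thesis by simp
qed

lemma open_contains_cylinder: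
  assumes "openin (full_shift A) U" "x \<in> U"
  shows "\<exists>n. \<forall>y. (\<forall>i. y i \<in> A) \<and> (\<forall>i. \<bar>i\<bar> \<le> int n \<longrightarrow> y i = x i) \<longrightarrow> y \<in> U"
proof -
  obtain V where V: "finite {i. V i \<noteq> A}" "x \<in> Pi\<^sub>E UNIV V" "Pi\<^sub>E UNIV V \<subseteq> U"
    using assms unfolding full_shift_def openin_product_topology_alt by auto
  \<comment> \<open>The 0 keeps the maximum defined when no coordinate is restricted.\<close>
  define b where "b = Max (insert 0 (abs ` {i. V i \<noteq> A}))"
  have b: "0 \<le> b" "\<And>i. V i \<noteq> A \<Longrightarrow> \<bar>i\<bar> \<le> b"
    using V(1) by (simp_all add: b_def)
  have "y \<in> U" if "\<forall>i. y i \<in> A" "\<forall>i. \<bar>i\<bar> \<le> int (nat b) \<longrightarrow> y i = x i" for y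
  proof -
    have "y i \<in> V i" for i
    proof (cases "V i = A")
      case True
      then show ?thesis using that(1) by simp
    next
      case False
      then have "y i = x i" using that(2) b by simp
      then show ?thesis using V(2) by auto
    qed
    then show ?thesis using V(3) by auto
  qed
  then show ?thesis by blast
qed

text \<open>The compactness argument of the Curtis-Hedlund-Lyndon theorem at coordinate 0;
  translations carry it to the other coordinates.\<close>

lemma continuous_map_window:
  assumes "finite A" "closedin (full_shift A) X"
    and h: "continuous_map (subtopology (full_shift A) X) (full_shift B) h"
  shows "\<exists>n. \<forall>x\<in>X. \<forall>y\<in>X. (\<forall>i. \<bar>i\<bar> \<le> int n \<longrightarrow> x i = y i) \<longrightarrow> h x 0 = h y 0"
proof -
  have XA: "x i \<in> A" if "x \<in> X" for x i
    using that closedin_subset[OF assms(2)] by (auto simp: topspace_full_shift)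
  define cyl where "cyl x n = {y. (\<forall>i. y i \<in> A) \<and> (\<forall>i. \<bar>i\<bar> \<le> int n \<longrightarrow> y i = x i)}" for x and n :: nat
  \<comment> \<open>Singletons are open in the discrete alphabet, so the points whose image has a
    given symbol at 0 form a relatively open set, which contains a cylinder around each of its
    points.\<close>
  have "\<exists>n. \<forall>y\<in>X \<inter> cyl x n. h y 0 = h x 0" if x: "x \<in> X" for x
  proof -
    have X: "topspace (subtopology (full_shift A) X) = X"
      using closedin_subset[OF assms(2)] by auto
    have "h x \<in> topspace (full_shift B)"
      using continuous_map_image_subset_topspace[OF h] x unfolding X by blast
    then have hx: "h x 0 \<in> B" by (simp add: topspace_full_shift)
    have "continuous_map (full_shift B) (discrete_topology B) (\<lambda>y. y 0)"
      unfolding full_shift_def by (rule continuous_map_product_projection) simp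
    from continuous_map_compose[OF h this]
    have "continuous_map (subtopology (full_shift A) X) (discrete_topology B) (\<lambda>y. h y 0)"
      by (simp add: comp_def)
    then have "openin (subtopology (full_shift A) X)
        {y \<in> topspace (subtopology (full_shift A) X). h y 0 \<in> {h x 0}}"
      by (rule openin_continuous_map_preimage) (simp add: hx)
    then obtain U where U: "openin (full_shift A) U" "{y \<in> X. h y 0 = h x 0} = U \<inter> X"
      unfolding X openin_subtopology by auto
    then have "x \<in> U" using x by blast
    from open_contains_cylinder[OF U(1) this] obtain n where "cyl x n \<subseteq> U"
      unfolding cyl_def by blast
    then show ?thesis using U(2) by blast
  qed
  then have "\<exists>N. \<forall>x\<in>X. \<forall>y\<in>X \<inter> cyl x (N x). h y 0 = h x 0" by (intro bchoice ballI)
  then obtain N where N: "\<And>x y. x \<in> X \<Longrightarrow> y \<in> X \<Longrightarrow> y \<in> cyl x (N x) \<Longrightarrow> h y 0 = h x 0"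
    by blast
  have "compact_space (full_shift A)"
    unfolding full_shift_def by (simp add: compact_space_product_topology assms(1) compact_space_discrete_topology)
  then have "compactin (full_shift A) X"
    using assms(2) by (rule closedin_compact_space)
  moreover have "\<forall>U\<in>(\<lambda>x. cyl x (N x)) ` X. openin (full_shift A) U"
    using openin_cylinder XA unfolding cyl_def by blast
  moreover have "X \<subseteq> \<Union> ((\<lambda>x. cyl x (N x)) ` X)" using XA by (auto simp: cyl_def)
  ultimately obtain F where F: "finite F" "F \<subseteq> (\<lambda>x. cyl x (N x)) ` X" "X \<subseteq> \<Union> F"
    unfolding compactin_def by (elim conjE allE[of _ "(\<lambda>x. cyl x (N x)) ` X"]) blast
  obtain T where T: "T \<subseteq> X" "finite T" "F = (\<lambda>x. cyl x (N x)) ` T"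
    using finite_subset_image[OF F(1,2)] by blast
  \<comment> \<open>The largest radius in a finite subcover: two points that agree up to it lie in a
    common cylinder of the subcover.\<close>
  define n where "n = Max (insert 0 (N ` T))"
  have n: "N t \<le> n" if "t \<in> T" for t using T(2) that by (simp add: n_def)
  have "h x 0 = h y 0" if xy: "x \<in> X" "y \<in> X" "\<forall>i. \<bar>i\<bar> \<le> int n \<longrightarrow> x i = y i" for x y
  proof -
    obtain t where t: "t \<in> T" "x \<in> cyl t (N t)" using F(3) T(3) xy(1) by blast
    then have "y i = t i" if "\<bar>i\<bar> \<le> int (N t)" for i
      using that n[OF t(1)] xy(3) by (force simp: cyl_def)
    then have "y \<in> cyl t (N t)" using XA[OF xy(2)] by (simp add: cyl_def)
    then show ?thesis using N[of t] t T(1) xy by (metis subsetD)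
  qed
  then show ?thesis by blast
qed

section \<open>Translations and the conclusion\<close>

definition translate :: "int \<Rightarrow> (int \<Rightarrow> 'a) \<Rightarrow> int \<Rightarrow> 'a" where
  "translate i x = (\<lambda>k. x (i + k))"

lemma translate_add_1: "translate (i + 1) x = shift (translate i x)"
  by (simp add: translate_def shift_def algebra_simps)

lemma shift_eq_translateD:
  assumes "shift y = translate i x" shows "y = translate (i - 1) x"
proof
  fix k
  show "y k = translate (i - 1) x k"
    using fun_cong[OF assms, of "k - 1"] by (simp add: translate_def shift_def algebra_simps)
qed

lemma translate_mem_and_commute:
  assumes X: "shift ` X = X" and h: "\<forall>x\<in>X. h (shift x) = shift (h x)" and x: "x \<in> X"
  shows "translate i x \<in> X \<and> h (translate i x) = translate i (h x)"
proof (induction i rule: int_induct[of _ 0])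
  case base
  then show ?case using x by (simp add: translate_def)
next
  case (step1 i)
  then show ?case using h X by (auto simp: translate_add_1)
next
  case (step2 i)
  \<comment> \<open>Leftward, a preimage comes from surjectivity of the shift on \<open>X\<close>;
    since the shift is injective on sequences, it can then be cancelled.\<close>
  then obtain y where y: "y \<in> X" "shift y = translate i x" using X by (metis imageE)
  then have "shift (h y) = translate i (h x)" using step2 h by metis
  then have "h y = translate (i - 1) (h x)" by (rule shift_eq_translateD)
  moreover have "y = translate (i - 1) x" using y(2) by (rule shift_eq_translateD)
  ultimately show ?case using y(1) by simp
qed

text \<open>Replaces symbols of an arbitrary type by numbers, as the intermediate systems of a chain
  require, and passes from the alphabet \<open>A\<close> to the symbols that occur. It is a
  bipartite code with a constant letter.\<close>

lemma sse_one_step_recode: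
  fixes p :: "'z \<Rightarrow> int \<Rightarrow> 'a" and g :: "'a \<Rightarrow> nat"
  assumes "finite A" "inj_on g A" "\<forall>z\<in>Z. \<forall>i. p z i \<in> A"
    and "lambda_synchronizing (p ` Z)" "vertex_enumeration (p ` Z) e"
  shows "finite_synchronizing Z (\<lambda>z i. g (p z i)) \<and>
    sse_one_step (lambda_sms A (p ` Z) e) (sms_of Z (\<lambda>z i. g (p z i)))"
proof -
  let ?q = "\<lambda>z i. g (p z i)"
  have "symbols_of Z ?q \<subseteq> g ` A" using assms(3) by (auto simp: symbols_of_def)
  then have fin: "finite (symbols_of Z ?q)" by (rule finite_subset) (use assms(1) in simp)
  have inj: "inj_on (\<lambda>a. (0 :: nat, g a)) A" "inj_on (\<lambda>n. (n, 0 :: nat)) (symbols_of Z ?q)"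
    using assms(2) by (simp_all add: inj_on_def)
  note step = sse_one_step_bipartite[OF assms(1) fin inj assms(3) symbols_of_all,
      of "\<lambda>z i. 0" ?q, simplified]
  show ?thesis
    using step assms(4,5) fin vertex_enumeration_some[OF fin] by (simp add: finite_synchronizing_def sms_of_def)
qed

theorem proposition3p5:
  fixes A :: "'a set" and A' :: "'b set"
    and X :: "(int \<Rightarrow> 'a) set" and X' :: "(int \<Rightarrow> 'b) set"
    and e :: "nat \<Rightarrow> nat \<Rightarrow> 'a list set" and e' :: "nat \<Rightarrow> nat \<Rightarrow> 'b list set"
  assumes "finite A" and "finite A'"
    and "subshift A X" and "subshift A' X'"
    and "lambda_synchronizing X" and "lambda_synchronizing X'"
    and "topologically_conjugate A X A' X'"
    and "vertex_enumeration X e" and "vertex_enumeration X' e'"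
  shows "strong_shift_equivalent (lambda_sms A X e) (lambda_sms A' X' e')"
proof -
  have X: "shift ` X = X" and X': "shift ` X' = X'" and cl: "closedin (full_shift A) X"
    and cl': "closedin (full_shift A') X'"
    using assms(3,4) by (simp_all add: subshift_def)
  have XA: "x i \<in> A" if "x \<in> X" for x i
    using that closedin_subset[OF cl] by (auto simp: topspace_full_shift)
  have XA': "x i \<in> A'" if "x \<in> X'" for x i
    using that closedin_subset[OF cl'] by (auto simp: topspace_full_shift)
  have top: "topspace (subtopology (full_shift A) X) = X" "topspace (subtopology (full_shift A') X') = X'"
    using closedin_subset[OF cl] closedin_subset[OF cl'] by auto
  obtain h where hom: "homeomorphic_map (subtopology (full_shift A) X) (subtopology (full_shift A') X') h"
    and eq: "\<forall>x\<in>X. h (shift x) = shift (h x)"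
    using assms(7) unfolding topologically_conjugate_def by blast
  obtain g where gh: "homeomorphic_maps (subtopology (full_shift A) X) (subtopology (full_shift A') X') h g"
    using hom unfolding homeomorphic_map_maps by blast
  have inv: "g (h x) = x" if "x \<in> X" for x
    using gh that top unfolding homeomorphic_maps_def by auto
  have hX: "h ` X = X'" using homeomorphic_imp_surjective_map[OF hom] unfolding top .
  have "continuous_map (subtopology (full_shift A) X) (full_shift A') h"
    and "continuous_map (subtopology (full_shift A') X') (full_shift A) g"
    using gh unfolding homeomorphic_maps_def continuous_map_in_subtopology by blast+
  then obtain n m where
    n: "\<And>x y. x \<in> X \<Longrightarrow> y \<in> X \<Longrightarrow> (\<And>i. \<bar>i\<bar> \<le> int n \<Longrightarrow> x i = y i) \<Longrightarrow> h x 0 = h y 0" and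
    m: "\<And>x y. x \<in> X' \<Longrightarrow> y \<in> X' \<Longrightarrow> (\<And>i. \<bar>i\<bar> \<le> int m \<Longrightarrow> x i = y i) \<Longrightarrow> g x 0 = g y 0"
    using continuous_map_window[OF assms(1) cl] continuous_map_window[OF assms(2) cl'] by metis
  obtain a :: "'a \<Rightarrow> nat" where a: "inj_on a A"
    using finite_imp_inj_to_nat_seg[OF assms(1)] by blast
  obtain b :: "'b \<Rightarrow> nat" where b: "inj_on b A'"
    using finite_imp_inj_to_nat_seg[OF assms(2)] by blast
  \<comment> \<open>Both subshifts are presented over the points of \<open>X\<close>:
    \<open>?p\<close> gives \<open>X\<close> itself and \<open>?q\<close> its image
    \<open>X'\<close> under \<open>h\<close>, with symbols renamed to numbers.\<close>
  let ?p = "\<lambda>x i. a (x i)" and ?q = "\<lambda>x i. b (h x i)"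
  note tr = translate_mem_and_commute[OF X eq]
  have aA: "a (x i) = a (y j) \<longleftrightarrow> x i = y j" if "x \<in> X" "y \<in> X" for x y i j
    using a XA that by (simp add: inj_on_eq_iff)
  have bA: "b (x i) = b (y j) \<longleftrightarrow> x i = y j" if "x \<in> X'" "y \<in> X'" for x y i j
    using b XA' that by (simp add: inj_on_eq_iff)
  have chain: "(step_related X)\<^sup>*\<^sup>* ?p ?q"
  proof (rule conjugate_chain)
    fix x y i j assume xy: "x \<in> X" "y \<in> X"
      and agree: "\<And>k. \<bar>k\<bar> \<le> int n \<Longrightarrow> a (x (i + k)) = a (y (j + k))"
    \<comment> \<open>Moving the places i and j to 0 reduces the claim to the window of
      \<open>h\<close> at coordinate 0.\<close>
    have "h (translate i x) 0 = h (translate j y) 0"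
      by (rule n) (use tr xy agree aA[OF xy] in \<open>simp_all add: translate_def\<close>)
    then show "b (h x i) = b (h y j)" using tr xy by (simp add: translate_def)
  next
    fix x y i j assume xy: "x \<in> X" "y \<in> X"
      and agree: "\<And>k. \<bar>k\<bar> \<le> int m \<Longrightarrow> b (h x (i + k)) = b (h y (j + k))"
    have h: "h x \<in> X'" "h y \<in> X'" using hX xy by blast+
    have t: "translate i x \<in> X" "translate j y \<in> X" using tr xy by blast+
    have "g (h (translate i x)) 0 = g (h (translate j y)) 0"
    proof (rule m)
      show "h (translate i x) \<in> X'" "h (translate j y) \<in> X'" using hX t by blast+
      show "h (translate i x) k = h (translate j y) k" if "\<bar>k\<bar> \<le> int m" for k
        using tr xy agree[OF that] bA[OF h] by (simp add: translate_def)
    qed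
    then have "x i = y j" unfolding inv[OF t(1)] inv[OF t(2)] by (simp add: translate_def)
    then show "a (x i) = a (y j)" by simp
  qed
  have idX: "(\<lambda>x. x) ` X = X" by simp
  have "\<forall>x\<in>X. \<forall>i. x i \<in> A" using XA by blast
  from sse_one_step_recode[OF assms(1) a this] have
    start: "finite_synchronizing X ?p" "sse_one_step (lambda_sms A X e) (sms_of X ?p)"
    using assms(5,8) by simp_all
  have "\<forall>x\<in>X. \<forall>i. h x i \<in> A'" using XA' hX by blast
  \<comment> \<open>The sequences \<open>h x\<close> present \<open>X'\<close>, so the recoding of
    \<open>X'\<close> ends at the same system as the chain; reversed, it is the last step.\<close>
  from sse_one_step_recode[OF assms(2) b this, unfolded hX] have
    final: "sse_one_step (lambda_sms A' X' e') (sms_of X ?q)"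
    using assms(6,9) by blast
  have "sse_one_step\<^sup>*\<^sup>* (sms_of X ?p) (sms_of X ?q)"
    using step_related_chain_sse[OF chain start(1)] by blast
  then show ?thesis
    unfolding strong_shift_equivalent_def using start(2) sse_one_step_sym[OF final] by blast
qed

end
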